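(* Given the pairwise frequencies $f_X(a,b)$ for all $a,b \in \{1,\ldots,n\}$ of a search sequence $X$, a static binary search tree $T$ on $\{1,\ldots,n\}$ minimizing the lazy finger execution time $R_\ell(T,X)$ of $X$ can be found in $O(n^3)$ time.
   Context: A search sequence is $X = x_1,\ldots,x_m$ with $x_i \in \{1,\ldots,n\}$. $f_X(a,b)$ is the number of indices $i$ such that $x_i = b$ and $x_{i-1} = a$ (the number of searches to $b$ immediately preceded by a search to $a$). For a static BST $T$ on keys $1,\ldots,n$, with $d_T$ the depth (root at depth $0$) and $\mathrm{LCA}_T$ the lowest common ancestor, $r(T,i,j) = d_T(i)+d_T(j)-2d_T(\mathrm{LCA}_T(i,j))$, and the lazy finger cost is $R_\ell(T,X) = \sum_{i=1}^m r(T,x_{i-1},x_i)$, where $x_0$ is the root of $T$. Time is measured in a model where arithmetic on frequencies takes $O(1)$ time.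
   Formalization: When X starts and ends with the same key, the algorithm is also given that key x_1, since the frequencies alone do not determine an optimal tree (1,2,1 and 2,1,2 have equal frequencies but no common optimal tree); n and m are at least 1. *)

theory Defs
  imports "HOL-Library.Tree" "HOL-Library.Landau_Symbols"
begin

section \<open>Binary search trees and the lazy finger cost\<close>

definition bst_on :: "nat \<Rightarrow> nat tree \<Rightarrow> bool" where
  "bst_on n T \<longleftrightarrow> bst T \<and> set_tree T = {1..n}"

text \<open>Only meaningful for keys of a search tree; the value on \<open>Leaf\<close> is never used.\<close>

fun depth :: "'a::linorder tree \<Rightarrow> 'a \<Rightarrow> nat" where
  "depth \<langle>\<rangle> x = 0"
| "depth \<langle>l, k, r\<rangle> x =
     (if x = k then 0 else if x < k then Suc (depth l x) else Suc (depth r x))"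

text \<open>A node is an ancestor of itself.\<close>

definition ancestor :: "'a tree \<Rightarrow> 'a \<Rightarrow> 'a \<Rightarrow> bool" where
  "ancestor T a x \<longleftrightarrow> (\<exists>l r. \<langle>l, a, r\<rangle> \<in> subtrees T \<and> x \<in> set_tree \<langle>l, a, r\<rangle>)"

definition lca :: "'a::linorder tree \<Rightarrow> 'a \<Rightarrow> 'a \<Rightarrow> 'a" where
  "lca T i j = (ARG_MAX (depth T) a. ancestor T a i \<and> ancestor T a j)"

definition finger_dist :: "'a::linorder tree \<Rightarrow> 'a \<Rightarrow> 'a \<Rightarrow> int" where
  "finger_dist T i j = int (depth T i) + int (depth T j) - 2 * int (depth T (lca T i j))"

text \<open>
  A search sequence is a list; its entry \<open>x\<^sub>i\<close> is \<open>X ! (i - 1)\<close>.  Prefixing the root of the tree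
  makes \<open>x\<^sub>0\<close> the root and \<open>(value T # X) ! i\<close> the entry \<open>x\<^sub>i\<close>.
\<close>

definition lazy_finger_cost :: "'a::linorder tree \<Rightarrow> 'a list \<Rightarrow> int" where
  "lazy_finger_cost T X =
     (\<Sum>i = 1..length X. finger_dist T ((value T # X) ! (i - 1)) ((value T # X) ! i))"

definition freq :: "'a list \<Rightarrow> 'a \<Rightarrow> 'a \<Rightarrow> nat" where
  "freq X a b = card {i \<in> {1..<length X}. X ! i = b \<and> X ! (i - 1) = a}"

definition optimal_bst :: "nat \<Rightarrow> nat list \<Rightarrow> nat tree \<Rightarrow> bool" where
  "optimal_bst n X T \<longleftrightarrow>
     bst_on n T \<and> (\<forall>T'. bst_on n T' \<longrightarrow> lazy_finger_cost T X \<le> lazy_finger_cost T' X)"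


section \<open>The machine model\<close>

text \<open>
  A unit-cost random access machine, presented as a structured language over integer variables
  and two-dimensional integer arrays.  Every addition, subtraction, comparison, Boolean connective,
  variable or array access, assignment and branch costs one step.  There is no multiplication, so
  a step lengthens the largest number in play by at most a constant number of bits.
\<close>

type_synonym vname = string

record store =
  var :: "vname \<Rightarrow> int"
  arr :: "vname \<Rightarrow> int \<Rightarrow> int \<Rightarrow> int"

datatype aexp =
    Num int
  | Var vname
  | Get vname aexp aexp
  | Plus aexp aexp
  | Minus aexp aexp

datatype bexp =
    Less aexp aexp
  | Neg bexp
  | Conj bexp bexp

datatype com =
    SKIP
  | Assign vname aexp
  | Put vname aexp aexp aexp
  | Seq com com
  | IF bexp com com
  | WHILE bexp com

primrec aval :: "aexp \<Rightarrow> store \<Rightarrow> int" where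
  "aval (Num c) s = c"
| "aval (Var x) s = var s x"
| "aval (Get A i j) s = arr s A (aval i s) (aval j s)"
| "aval (Plus a b) s = aval a s + aval b s"
| "aval (Minus a b) s = aval a s - aval b s"

primrec atime :: "aexp \<Rightarrow> nat" where
  "atime (Num c) = 1"
| "atime (Var x) = 1"
| "atime (Get A i j) = 1 + atime i + atime j"
| "atime (Plus a b) = 1 + atime a + atime b"
| "atime (Minus a b) = 1 + atime a + atime b"

primrec bval :: "bexp \<Rightarrow> store \<Rightarrow> bool" where
  "bval (Less a b) s \<longleftrightarrow> aval a s < aval b s"
| "bval (Neg b) s \<longleftrightarrow> \<not> bval b s"
| "bval (Conj b c) s \<longleftrightarrow> bval b s \<and> bval c s"

primrec btime :: "bexp \<Rightarrow> nat" where
  "btime (Less a b) = 1 + atime a + atime b"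
| "btime (Neg b) = 1 + btime b"
| "btime (Conj b c) = 1 + btime b + btime c"

definition put :: "vname \<Rightarrow> int \<Rightarrow> int \<Rightarrow> int \<Rightarrow> store \<Rightarrow> store" where
  "put A i j v s = s\<lparr>arr := (arr s)(A := (arr s A)(i := (arr s A i)(j := v)))\<rparr>"

text \<open>\<open>exec c s t s'\<close>: started in \<open>s\<close>, the command \<open>c\<close> halts in \<open>s'\<close> after exactly \<open>t\<close> steps.\<close>

inductive exec :: "com \<Rightarrow> store \<Rightarrow> nat \<Rightarrow> store \<Rightarrow> bool" where
  Skip: "exec SKIP s 1 s"
| Assign: "exec (Assign x a) s (1 + atime a) (s\<lparr>var := (var s)(x := aval a s)\<rparr>)"
| Put: "exec (Put A i j a) s (1 + atime i + atime j + atime a)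
          (put A (aval i s) (aval j s) (aval a s) s)"
| Seq: "exec c s t s' \<Longrightarrow> exec d s' u s'' \<Longrightarrow> exec (Seq c d) s (t + u) s''"
| IfTrue: "bval b s \<Longrightarrow> exec c s t s' \<Longrightarrow> exec (IF b c d) s (1 + btime b + t) s'"
| IfFalse: "\<not> bval b s \<Longrightarrow> exec d s t s' \<Longrightarrow> exec (IF b c d) s (1 + btime b + t) s'"
| WhileFalse: "\<not> bval b s \<Longrightarrow> exec (WHILE b c) s (1 + btime b) s"
| WhileTrue: "bval b s \<Longrightarrow> exec c s t s' \<Longrightarrow> exec (WHILE b c) s' u s'' \<Longrightarrow>
    exec (WHILE b c) s (1 + btime b + t + u) s''"

inductive_cases SkipE: "exec SKIP s t s'"
inductive_cases AssignE: "exec (Assign x a) s t s'"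
inductive_cases PutE: "exec (Put A i j a) s t s'"
inductive_cases SeqE: "exec (Seq c d) s t s'"
inductive_cases IfE: "exec (IF b c d) s t s'"
inductive_cases WhileE: "exec (WHILE b c) s t s'"

lemma exec_deterministic:
  "exec c s t s' \<Longrightarrow> exec c s u s'' \<Longrightarrow> t = u \<and> s' = s''"
proof (induction arbitrary: u s'' rule: exec.induct)
  case (Seq c s t s' d v s1)
  from Seq.prems show ?case
    by (rule SeqE) (metis Seq.IH)
next
  case (WhileTrue b s c t s' v s1)
  from WhileTrue.prems show ?case
  proof (rule WhileE)
    fix t2 s2 v2
    assume "u = Suc (btime b + t2 + v2)" "exec c s t2 s2" "exec (WHILE b c) s2 v2 s''"
    with WhileTrue.IH(1)[of t2 s2] WhileTrue.IH(2)[of v2 s''] show ?thesis by simp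
  qed (use WhileTrue.hyps in simp)
next
  case (WhileFalse b s c)
  from WhileFalse.prems show ?case
    by (rule WhileE) (use WhileFalse.hyps in simp_all)
next
  case (IfTrue b s c t s' d)
  from IfTrue.prems show ?case
    by (rule IfE) (use IfTrue.hyps IfTrue.IH in fastforce)+
next
  case (IfFalse b s d t s' c)
  from IfFalse.prems show ?case
    by (rule IfE) (use IfFalse.hyps IfFalse.IH in fastforce)+
qed (auto elim: SkipE AssignE PutE)


section \<open>Input and output conventions\<close>

text \<open>
  The variable \<open>n\<close>, the table \<open>f\<close> on \<open>{1..n} \<times> {1..n}\<close>, and a number \<open>h\<close> in the variable \<open>first\<close>;
  everything else is zero.
\<close>

definition input_store :: "nat \<Rightarrow> (nat \<Rightarrow> nat \<Rightarrow> nat) \<Rightarrow> nat \<Rightarrow> store" where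
  "input_store n f h = \<lparr>
     var = (\<lambda>_. 0)(''n'' := int n, ''first'' := int h),
     arr = (\<lambda>_ _ _. 0)(''f'' := (\<lambda>a b. if a \<in> {1..int n} \<and> b \<in> {1..int n}
                                       then int (f (nat a) (nat b)) else 0))\<rparr>"

text \<open>
  Trees are output as linked structures: a node is addressed by its key, its children are found in
  column 0 of the arrays \<open>left\<close> and \<open>right\<close>, and \<open>0\<close> is the null pointer.
\<close>

primrec tree_at :: "store \<Rightarrow> int \<Rightarrow> nat tree \<Rightarrow> bool" where
  "tree_at s p \<langle>\<rangle> \<longleftrightarrow> p = 0"
| "tree_at s p \<langle>l, k, r\<rangle> \<longleftrightarrow> p = int k \<and> p \<noteq> 0 \<and>
     tree_at s (arr s ''left'' p 0) l \<and> tree_at s (arr s ''right'' p 0) r"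

definition outputs_tree :: "store \<Rightarrow> nat tree \<Rightarrow> bool" where
  "outputs_tree s T \<longleftrightarrow> tree_at s (var s ''root'') T"

text \<open>
  The number \<open>h\<close> is for a degenerate case.  The initial search from the root contributes the depth
  of \<open>x\<^sub>1\<close> to the cost of \<open>X\<close>.  The frequencies determine \<open>x\<^sub>1\<close>, as the only key with more departures
  than arrivals, unless \<open>X\<close> starts and ends with the same key.  In that case they need not even
  determine an optimal tree (\<open>freq_insufficient\<close> below), so \<open>h\<close> has to be that key; in all other
  cases \<open>h\<close> is arbitrary and the frequencies are the only information about \<open>X\<close>.
\<close>

lemma finger_dist_2:
  assumes "T = \<langle>\<langle>\<rangle>, 1, \<langle>\<langle>\<rangle>, 2, \<langle>\<rangle>\<rangle>\<rangle> \<or> T = \<langle>\<langle>\<langle>\<rangle>, 1, \<langle>\<rangle>\<rangle>, 2 :: nat, \<langle>\<rangle>\<rangle>"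
    and "i = 1 \<or> i = 2" "j = 1 \<or> j = 2"
  shows "finger_dist T i j = (if i = j then 0 else 1)"
proof (cases "i = j")
  case True
  have "depth T (lca T i j) = depth T i"
    unfolding lca_def by (rule arg_max_equality) (use assms True in \<open>auto simp: ancestor_def\<close>)
  then show ?thesis using True by (simp add: finger_dist_def)
next
  case False
  have "depth T (lca T i j) = depth T (value T)"
    unfolding lca_def by (rule arg_max_equality) (use assms False in \<open>auto simp: ancestor_def\<close>)
  then have "depth T (lca T i j) = 0" using assms(1) by auto
  then show ?thesis using False assms by (auto simp: finger_dist_def)
qed

lemma bst_on_2:
  "bst_on 2 T \<longleftrightarrow>
     T = \<langle>\<langle>\<rangle>, 1, \<langle>\<langle>\<rangle>, 2, \<langle>\<rangle>\<rangle>\<rangle> \<or> T = \<langle>\<langle>\<langle>\<rangle>, 1, \<langle>\<rangle>\<rangle>, 2, \<langle>\<rangle>\<rangle>"  (is "?L \<longleftrightarrow> ?R")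
proof
  assume ?L
  then have "bst T" and keys: "set_tree T = {1..2}"
    by (simp_all add: bst_on_def)
  then have sorted: "sorted_wrt (<) (inorder T)"
    by (simp only: bst_iff_sorted_wrt_less)
  have "{1..2 :: nat} = {1, 2}" by auto
  with keys have "set (inorder T) = set [1, 2]" by simp
  then have I: "inorder T = [1, 2]"
    using strict_sorted_equal[OF _ sorted, of "[1, 2]"] by simp
  have leaf: "t = \<langle>\<langle>\<rangle>, x, \<langle>\<rangle>\<rangle>" if "inorder t = [x]" for t and x :: nat
    using that by (cases t) (simp_all add: append_eq_Cons_conv)
  obtain l k r where T: "T = \<langle>l, k, r\<rangle>"
    using I by (cases T) auto
  have "(l = \<langle>\<rangle> \<and> k = 1 \<and> inorder r = [2]) \<or> (inorder l = [1] \<and> k = 2 \<and> r = \<langle>\<rangle>)"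
    using I unfolding T by (cases "inorder l") (simp_all add: append_eq_Cons_conv)
  then show ?R
    unfolding T using leaf by blast
next
  have keys: "{1..2 :: nat} = {1, 2}" by auto
  assume ?R
  then show ?L
    unfolding bst_on_def keys by (elim disjE) (simp_all add: insert_commute)
qed

lemma freq_insufficient:
  "freq [1, 2, 1] = freq [2, 1, 2 :: nat] \<and>
   \<not> (\<exists>T. optimal_bst 2 [1, 2, 1] T \<and> optimal_bst 2 [2, 1, 2] T)"
proof
  have I: "{1..<length [x, y, z]} = {1, 2}" for x y z :: nat by auto
  show "freq [1, 2, 1] = freq [2, 1, 2 :: nat]"
  proof (intro ext)
    fix a b :: nat
    have "{i \<in> {1..<length [1, 2, 1 :: nat]}. [1, 2, 1] ! i = b \<and> [1, 2, 1] ! (i - 1) = a} =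
       (if a = 1 \<and> b = 2 then {1} else if a = 2 \<and> b = 1 then {2} else {})"
     "{i \<in> {1..<length [2, 1, 2 :: nat]}. [2, 1, 2] ! i = b \<and> [2, 1, 2] ! (i - 1) = a} =
       (if a = 1 \<and> b = 2 then {2} else if a = 2 \<and> b = 1 then {1} else {})"
      unfolding I by (auto split: if_splits)
    then show "freq [1, 2, 1] a b = freq [2, 1, 2] a b"
      unfolding freq_def by (simp only:) simp
  qed
  let ?A = "\<langle>\<langle>\<rangle>, 1, \<langle>\<langle>\<rangle>, 2 :: nat, \<langle>\<rangle>\<rangle>\<rangle>" and ?B = "\<langle>\<langle>\<langle>\<rangle>, 1, \<langle>\<rangle>\<rangle>, 2 :: nat, \<langle>\<rangle>\<rangle>"
  have "lazy_finger_cost T [x, y, z] =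
      finger_dist T (value T) x + finger_dist T x y + finger_dist T y z"
    for T :: "nat tree" and x y z
  proof -
    have "{1..length [x, y, z]} = {1, 2, 3}" by auto
    then show ?thesis unfolding lazy_finger_cost_def by (simp only:) simp
  qed
  then have costs: "lazy_finger_cost ?A [1, 2, 1] = 2" "lazy_finger_cost ?A [2, 1, 2] = 3"
    "lazy_finger_cost ?B [1, 2, 1] = 3" "lazy_finger_cost ?B [2, 1, 2] = 2"
    using finger_dist_2[of ?A] finger_dist_2[of ?B] by simp_all
  have "bst_on 2 ?A" "bst_on 2 ?B"
    unfolding bst_on_2 by blast+
  then have "\<not> optimal_bst 2 [1, 2, 1] ?B" "\<not> optimal_bst 2 [2, 1, 2] ?A"
    unfolding optimal_bst_def using costs by force+
  then show "\<not> (\<exists>T. optimal_bst 2 [1, 2, 1] T \<and> optimal_bst 2 [2, 1, 2] T)"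
    using bst_on_2 optimal_bst_def by metis
qed

end

theory Submission
  imports Defs
begin

text \<open>
  The path between two keys crosses the edge above a node iff the subtree of that node contains
  exactly one of them, and the keys of a subtree form an interval. Up to the constant 1, the cost of a
  tree is therefore the sum, over its subtrees, of a weight of the interval \<open>{i..j}\<close> of keys: the number
  of transitions entering or leaving \<open>{i..j}\<close>, plus 1 if \<open>x\<^sub>1\<close> lies in it. Such a sum is minimised by
  interval dynamic programming,
  \<open>C(i,j) = w(i,j) + min\<^sub>k (C(i,k-1) + C(k+1,j))\<close>,
  in time \<open>O(n\<^sup>3)\<close>; the weights come from \<open>w(i,j-1)\<close> in time \<open>O(n)\<close> each. The key \<open>x\<^sub>1\<close> is found
  by comparing departures with arrivals. The tree is read off the table of optimal roots by searching
  every key in it from the root, which needs no stack and costs \<open>O(n)\<close> per key.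
\<close>

section \<open>The cost as a sum over subtrees\<close>

text \<open>Two obstacles shape the proof. The initial finger is the root, which varies with the
  tree, so the first search is not obviously a sum of weights that are the same for all trees. But
  the root belongs to the key set of the whole tree only, so its distance to
  \<open>x\<^sub>1\<close> is the number of subtrees containing \<open>x\<^sub>1\<close>, minus one.
  This is the origin of both the extra term of the weight and the constant 1. The other obstacle is
  time: a weight evaluated from its definition costs O(n^2), hence O(n^4) over all intervals,
  whereas enlarging an interval by one key affects only the transitions at that key.

  Correctness of the tables is stated locally, as a Bellman equation for each entry, and not as
  minimality over trees. The loops can maintain a local condition, and minimality is derived from it
  once, after the tables are full. In the same spirit the pointers of a node are described by the
  search path of its key alone, so the linking loop is verified before any tree is
  exhibited.\<close>

fun lca_depth :: "'a::linorder tree \<Rightarrow> 'a \<Rightarrow> 'a \<Rightarrow> nat" where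
  "lca_depth \<langle>\<rangle> a b = 0"
| "lca_depth \<langle>l, k, r\<rangle> a b =
     (if a < k \<and> b < k then Suc (lca_depth l a b)
      else if k < a \<and> k < b then Suc (lca_depth r a b) else 0)"

lemma ancestor_Leaf [simp]: "\<not> ancestor \<langle>\<rangle> c x"
  by (simp add: ancestor_def)

lemma ancestor_Node:
  "ancestor \<langle>l, k, r\<rangle> c x \<longleftrightarrow>
     c = k \<and> x \<in> set_tree \<langle>l, k, r\<rangle> \<or> ancestor l c x \<or> ancestor r c x"
  unfolding ancestor_def by auto

lemma ancestor_in_set: "ancestor T c x \<Longrightarrow> c \<in> set_tree T \<and> x \<in> set_tree T"
  by (induction T) (auto simp: ancestor_Node)

text \<open>\<open>lca\<close> is an \<open>ARG_MAX\<close> and offers no recursion. Descending from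
  the root while both keys lie on the same side gives the depth of the lowest common ancestor
  recursively. Attainment and maximality are stated together because they are the two premises of
  \<open>arg_max_equality\<close>.\<close>

lemma lca_depth_correct:
  assumes "bst T" "a \<in> set_tree T" "b \<in> set_tree T"
  shows "(\<exists>c. ancestor T c a \<and> ancestor T c b \<and> depth T c = lca_depth T a b) \<and>
         (\<forall>c. ancestor T c a \<and> ancestor T c b \<longrightarrow> depth T c \<le> lca_depth T a b)"
  using assms
proof (induction T)
  case Leaf
  then show ?case by simp
next
  case (Node l k r)
  have lk: "\<forall>x\<in>set_tree l. x < k" and rk: "\<forall>x\<in>set_tree r. k < x" and bst: "bst l" "bst r"
    using Node.prems(1) by auto
  consider (l) "a < k" "b < k" | (r) "k < a" "k < b" | (m) "\<not> (a < k \<and> b < k)" "\<not> (k < a \<and> k < b)"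
    by blast
  then show ?case
  proof cases
    case l
    then have ab: "a \<in> set_tree l" "b \<in> set_tree l"
      using Node.prems rk by auto
    have nr: "\<not> ancestor r c a" "\<not> ancestor r c b" for c
      using l rk by (meson ancestor_in_set less_asym)+
    from Node.IH(1)[OF bst(1) ab] obtain c where
      c: "ancestor l c a" "ancestor l c b" "depth l c = lca_depth l a b" by blast
    have "c < k" using c(1) lk by (auto dest: ancestor_in_set)
    then have "ancestor \<langle>l, k, r\<rangle> c a \<and> ancestor \<langle>l, k, r\<rangle> c b \<and>
        depth \<langle>l, k, r\<rangle> c = lca_depth \<langle>l, k, r\<rangle> a b"
      using c l by (simp add: ancestor_Node)
    moreover have "depth \<langle>l, k, r\<rangle> d \<le> lca_depth \<langle>l, k, r\<rangle> a b"
      if d: "ancestor \<langle>l, k, r\<rangle> d a" "ancestor \<langle>l, k, r\<rangle> d b" for d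
    proof (cases "d = k")
      case False
      then have "ancestor l d a" "ancestor l d b"
        using d nr by (auto simp: ancestor_Node)
      moreover from this have "d < k" using lk by (auto dest: ancestor_in_set)
      ultimately show ?thesis
        using Node.IH(1)[OF bst(1) ab] l by simp
    qed simp
    ultimately show ?thesis by blast
  next
    case r
    then have ab: "a \<in> set_tree r" "b \<in> set_tree r"
      using Node.prems lk by auto
    have nr: "\<not> ancestor l c a" "\<not> ancestor l c b" for c
      using r lk by (meson ancestor_in_set less_asym)+
    from Node.IH(2)[OF bst(2) ab] obtain c where
      c: "ancestor r c a" "ancestor r c b" "depth r c = lca_depth r a b" by blast
    have "k < c" using c(1) rk by (auto dest: ancestor_in_set)
    then have "ancestor \<langle>l, k, r\<rangle> c a \<and> ancestor \<langle>l, k, r\<rangle> c b \<and>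
        depth \<langle>l, k, r\<rangle> c = lca_depth \<langle>l, k, r\<rangle> a b"
      using c r by (auto simp: ancestor_Node)
    moreover have "depth \<langle>l, k, r\<rangle> d \<le> lca_depth \<langle>l, k, r\<rangle> a b"
      if d: "ancestor \<langle>l, k, r\<rangle> d a" "ancestor \<langle>l, k, r\<rangle> d b" for d
    proof (cases "d = k")
      case False
      then have "ancestor r d a" "ancestor r d b"
        using d nr by (auto simp: ancestor_Node)
      moreover from this have "k < d" using rk by (auto dest: ancestor_in_set)
      ultimately show ?thesis
        using Node.IH(2)[OF bst(2) ab] r by auto
    qed simp
    ultimately show ?thesis by blast
  next
    case m
    have "d = k" if d: "ancestor \<langle>l, k, r\<rangle> d a" "ancestor \<langle>l, k, r\<rangle> d b" for d
    proof (rule ccontr)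
      assume "d \<noteq> k"
      with d have "ancestor l d a \<or> ancestor r d a" "ancestor l d b \<or> ancestor r d b"
        by (simp_all add: ancestor_Node)
      then show False
        using m lk rk by (meson ancestor_in_set less_asym)
    qed
    moreover have "ancestor \<langle>l, k, r\<rangle> k a" "ancestor \<langle>l, k, r\<rangle> k b"
      using Node.prems by (simp_all add: ancestor_Node)
    moreover have "lca_depth \<langle>l, k, r\<rangle> a b = 0"
      using m by simp
    ultimately show ?thesis by (metis depth.simps(2) le_refl)
  qed
qed

lemma depth_lca:
  assumes "bst T" "a \<in> set_tree T" "b \<in> set_tree T"
  shows "depth T (lca T a b) = lca_depth T a b"
proof -
  obtain c where c: "ancestor T c a \<and> ancestor T c b" "depth T c = lca_depth T a b"
    using lca_depth_correct[OF assms] by blast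
  have "depth T (lca T a b) = depth T c"
    unfolding lca_def using c lca_depth_correct[OF assms] by (intro arg_max_equality) auto
  with c show ?thesis by simp
qed

lemma depth_eq_lca_depth: "depth T a = lca_depth T a a"
  by (induction T) auto

fun node_sum :: "('a set \<Rightarrow> int) \<Rightarrow> 'a tree \<Rightarrow> int" where
  "node_sum W \<langle>\<rangle> = 0"
| "node_sum W \<langle>l, k, r\<rangle> = W (set_tree \<langle>l, k, r\<rangle>) + node_sum W l + node_sum W r"

lemma node_sum_add: "node_sum (\<lambda>S. U S + V S) T = node_sum U T + node_sum V T"
  by (induction T) auto

lemma node_sum_sum: "node_sum (\<lambda>S. \<Sum>x\<in>A. U x S) T = (\<Sum>x\<in>A. node_sum (U x) T)"
  by (induction T) (auto simp: sum.distrib)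

lemma node_sum_eq_0: "(\<And>S. S \<subseteq> set_tree T \<Longrightarrow> W S = 0) \<Longrightarrow> node_sum W T = 0"
  by (induction T) (auto simp: subset_insertI2 le_supI1 le_supI2)

text \<open>The subtrees containing both keys are those rooted at the common ancestors, one for each
  depth from 0 to that of the lowest; hence the summand 1. With \<open>a = b\<close> this counts the
  ancestors of a single key.\<close>

lemma node_sum_both:
  assumes "bst T" "a \<in> set_tree T" "b \<in> set_tree T"
  shows "node_sum (\<lambda>S. of_bool (a \<in> S \<and> b \<in> S)) T = int (lca_depth T a b) + 1"
  using assms
proof (induction T)
  case (Node l k r)
  have lk: "\<forall>x\<in>set_tree l. x < k" and rk: "\<forall>x\<in>set_tree r. k < x" and bst: "bst l" "bst r"
    using Node.prems(1) by auto
  have zero: "node_sum (\<lambda>S. of_bool (a \<in> S \<and> b \<in> S)) t = 0"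
    if "a \<notin> set_tree t \<or> b \<notin> set_tree t" for t
    using that by (intro node_sum_eq_0) auto
  consider (l) "a < k" "b < k" | (r) "k < a" "k < b" | (m) "\<not> (a < k \<and> b < k)" "\<not> (k < a \<and> k < b)"
    by blast
  then show ?case
  proof cases
    case l
    then have "a \<in> set_tree l" "b \<in> set_tree l" "a \<notin> set_tree r"
      using Node.prems(2,3) rk by (auto dest: less_asym)
    then show ?thesis using l Node.IH(1) bst zero[of r] by simp
  next
    case r
    then have "a \<in> set_tree r" "b \<in> set_tree r" "a \<notin> set_tree l"
      using Node.prems(2,3) lk by (auto dest: less_asym)
    then show ?thesis using r Node.IH(2) bst zero[of l] by auto
  next
    case m
    then have "a \<notin> set_tree l \<or> b \<notin> set_tree l" "a \<notin> set_tree r \<or> b \<notin> set_tree r"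
      using lk rk by auto
    then show ?thesis using m Node.prems zero[of l] zero[of r] by auto
  qed
qed simp

text \<open>Inclusion-exclusion in every subtree. By \<open>node_sum_both\<close> the counts are
  depths plus 1, and the added units cancel.\<close>

lemma finger_dist_eq_node_sum:
  assumes "bst T" "a \<in> set_tree T" "b \<in> set_tree T"
  shows "finger_dist T a b = node_sum (\<lambda>S. of_bool ((a \<in> S) \<noteq> (b \<in> S))) T"
proof -
  \<comment> \<open>The count for both keys is added twice rather than multiplied by 2, so that
    \<open>node_sum_add\<close> alone merges each side into a single
    \<open>node_sum\<close>.\<close>
  have "node_sum (\<lambda>S. of_bool ((a \<in> S) \<noteq> (b \<in> S))) T +
      (node_sum (\<lambda>S. of_bool (a \<in> S \<and> b \<in> S)) T + node_sum (\<lambda>S. of_bool (a \<in> S \<and> b \<in> S)) T) =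
      node_sum (\<lambda>S. of_bool (a \<in> S \<and> a \<in> S)) T + node_sum (\<lambda>S. of_bool (b \<in> S \<and> b \<in> S)) T"
    unfolding node_sum_add[symmetric] by (rule arg_cong[where f = "\<lambda>W. node_sum W T"]) auto
  then show ?thesis
    using assms by (simp only: node_sum_both finger_dist_def depth_lca
        depth_eq_lca_depth[of T a] depth_eq_lca_depth[of T b])
qed

lemma finger_dist_root:
  assumes "bst T" "a \<in> set_tree T"
  shows "finger_dist T (value T) a = node_sum (\<lambda>S. of_bool (a \<in> S)) T - 1"
proof -
  have "value T \<in> set_tree T" "lca_depth T (value T) a = 0" "depth T (value T) = 0"
    using assms(2) by (cases T; simp)+
  then show ?thesis
    using assms node_sum_both[OF assms(1,2,2)]
    by (simp add: finger_dist_def depth_lca depth_eq_lca_depth[of T a])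
qed

definition seq_weight :: "'a list \<Rightarrow> 'a set \<Rightarrow> int" where
  "seq_weight X S = of_bool (hd X \<in> S) +
     (\<Sum>i = 1..<length X. of_bool ((X ! (i - 1) \<in> S) \<noteq> (X ! i \<in> S)))"

lemma lazy_finger_cost_eq_node_sum:
  assumes "bst T" "X \<noteq> []" "set X \<subseteq> set_tree T"
  shows "lazy_finger_cost T X = node_sum (seq_weight X) T - 1"
proof -
  have mem: "X ! i \<in> set_tree T" if "i < length X" for i
    using assms(3) that nth_mem by blast
  \<comment> \<open>The search from the root is split off. After a shift by the prefixed root, the
    remaining summands no longer mention \<open>value T\<close>.\<close>
  have "lazy_finger_cost T X = finger_dist T (value T) (hd X) +
      (\<Sum>i = Suc 1..length X. finger_dist T ((value T # X) ! (i - 1)) ((value T # X) ! i))"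
    using assms(2) unfolding lazy_finger_cost_def
    by (subst sum.atLeast_Suc_atMost) (auto simp: hd_conv_nth Suc_le_eq)
  also have "(\<Sum>i = Suc 1..length X. finger_dist T ((value T # X) ! (i - 1)) ((value T # X) ! i)) =
      (\<Sum>i = 1..<length X. finger_dist T (X ! (i - 1)) (X ! i))"
    by (rule sum.reindex_bij_witness[of _ Suc "\<lambda>i. i - 1"]) (auto simp: nth_Cons')
  also have "\<dots> = (\<Sum>i = 1..<length X. node_sum (\<lambda>S. of_bool ((X ! (i - 1) \<in> S) \<noteq> (X ! i \<in> S))) T)"
    using assms(1) mem by (intro sum.cong refl finger_dist_eq_node_sum) auto
  also have "finger_dist T (value T) (hd X) = node_sum (\<lambda>S. of_bool (hd X \<in> S)) T - 1"
    using assms by (intro finger_dist_root) auto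
  finally show ?thesis
    unfolding seq_weight_def[abs_def] node_sum_add node_sum_sum by simp
qed

section \<open>Interval weights from frequencies\<close>

text \<open>Array indices of the machine are integers, so the tables below are indexed by integers.\<close>

definition int_freq :: "nat list \<Rightarrow> int \<Rightarrow> int \<Rightarrow> int" where
  "int_freq X a b = int (freq X (nat a) (nat b))"

lemma int_freq_eq_sum:
  assumes "0 \<le> a" "0 \<le> b"
  shows "int_freq X a b = (\<Sum>i = 1..<length X. of_bool (int (X ! (i - 1)) = a \<and> int (X ! i) = b))"
proof -
  have "freq X (nat a) (nat b) =
      card ({1..<length X} \<inter> {i. int (X ! (i - 1)) = a \<and> int (X ! i) = b})"
    unfolding freq_def using assms by (intro arg_cong[where f = card]) auto
  then show ?thesis
    unfolding int_freq_def by (simp add: of_bool_def sum.If_cases)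
qed

text \<open>Transitions are grouped by their pair of keys, so every quantity that is additive over
  transitions is computable from the frequencies. It serves for the balance of a key and for the
  crossings of an interval.\<close>

lemma sum_transitions:
  fixes \<phi> :: "int \<Rightarrow> int \<Rightarrow> int"
  assumes "set X \<subseteq> {1..n}"
  shows "(\<Sum>i = 1..<length X. \<phi> (int (X ! (i - 1))) (int (X ! i))) =
         (\<Sum>a = 1..int n. \<Sum>b = 1..int n. int_freq X a b * \<phi> a b)"
proof -
  have mem: "int (X ! i) \<in> {1..int n}" if "i < length X" for i
    using assms nth_mem[OF that] by auto
  have "(\<Sum>a = 1..int n. \<Sum>b = 1..int n. int_freq X a b * \<phi> a b) =
      (\<Sum>a = 1..int n. \<Sum>b = 1..int n. \<Sum>i = 1..<length X.
         of_bool (int (X ! (i - 1)) = a \<and> int (X ! i) = b) * \<phi> a b)"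
    by (intro sum.cong refl) (simp add: int_freq_eq_sum sum_distrib_right)
  also have "\<dots> = (\<Sum>i = 1..<length X. \<Sum>a = 1..int n. \<Sum>b = 1..int n.
         of_bool (int (X ! (i - 1)) = a \<and> int (X ! i) = b) * \<phi> a b)"
    by (simp only: sum.swap[where B = "{1..<length X}"])
  also have "\<dots> = (\<Sum>i = 1..<length X. \<phi> (int (X ! (i - 1))) (int (X ! i)))"
  proof (intro sum.cong refl)
    fix i assume "i \<in> {1..<length X}"
    then have "int (X ! (i - 1)) \<in> {1..int n}" "int (X ! i) \<in> {1..int n}"
      using mem by auto
    moreover have "(\<Sum>a = 1..int n. \<Sum>b = 1..int n. of_bool (int (X ! (i - 1)) = a \<and> int (X ! i) = b) * \<phi> a b)
       = (\<Sum>a = 1..int n. if int (X ! (i - 1)) = a then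
            (\<Sum>b = 1..int n. if int (X ! i) = b then \<phi> a b else 0) else 0)"
      by (intro sum.cong refl) (auto intro!: sum.cong)
    ultimately show "(\<Sum>a = 1..int n. \<Sum>b = 1..int n.
        of_bool (int (X ! (i - 1)) = a \<and> int (X ! i) = b) * \<phi> a b) =
        \<phi> (int (X ! (i - 1))) (int (X ! i))"
      by simp
  qed
  finally show ?thesis by simp
qed

text \<open>The sum telescopes along the sequence. A positive balance therefore identifies the first
  key; if the first and last keys coincide, all balances vanish.\<close>

lemma departures_minus_arrivals:
  assumes "X \<noteq> []" "set X \<subseteq> {1..n}" "a \<in> {1..int n}"
  shows "(\<Sum>b = 1..int n. int_freq X a b - int_freq X b a) =
         of_bool (int (hd X) = a) - of_bool (int (last X) = a)"
proof -
  define \<delta> where "\<delta> i = (of_bool (int (X ! i) = a) :: int)" for i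
  have "(\<Sum>b = 1..int n. int_freq X a b - int_freq X b a) =
      (\<Sum>c = 1..int n. \<Sum>b = 1..int n. int_freq X c b * of_bool (c = a)) -
      (\<Sum>c = 1..int n. \<Sum>b = 1..int n. int_freq X c b * of_bool (b = a))"
    using assms(3) sum.swap[of "\<lambda>c b. int_freq X c b * of_bool (c = a)" "{1..int n}" "{1..int n}"]
    by (simp add: sum_subtractf of_bool_def if_distrib cong: if_cong)
  also have "\<dots> = (\<Sum>i = 1..<length X. \<delta> (i - 1) - \<delta> i)"
    unfolding \<delta>_def sum_subtractf
    by (simp only: sum_transitions[OF assms(2), of "\<lambda>c b. of_bool (c = a)"]
        sum_transitions[OF assms(2), of "\<lambda>c b. of_bool (b = a)"])
  also have "\<dots> = \<delta> 0 - \<delta> (length X - 1)"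
  proof -
    have "(\<Sum>i = 1..<Suc m. \<delta> (i - 1) - \<delta> i) = \<delta> 0 - \<delta> m" for m
      by (induction m) auto
    from this[of "length X - 1"] show ?thesis using assms(1) by simp
  qed
  finally show ?thesis
    using assms(1) by (simp add: \<delta>_def hd_conv_nth last_conv_nth)
qed

text \<open>The weight of the cut between \<open>S\<close> and its complement in the graph with edge
  weights \<open>F\<close>, both directions counted.\<close>

definition crossings :: "(int \<Rightarrow> int \<Rightarrow> int) \<Rightarrow> int \<Rightarrow> int set \<Rightarrow> int" where
  "crossings F N S = (\<Sum>a = 1..N. \<Sum>b = 1..N. F a b * of_bool ((a \<in> S) \<noteq> (b \<in> S)))"

lemma crossings_empty [simp]: "crossings F N {} = 0"
  by (simp add: crossings_def)

text \<open>Only pairs involving \<open>j\<close> change: those leading outside begin to cross,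
  those leading into \<open>S\<close> cease to.\<close>

lemma crossings_insert:
  assumes "j \<in> {1..N}" "j \<notin> S"
  shows "crossings F N (insert j S) = crossings F N S +
    (\<Sum>b = 1..N. (F j b + F b j) * (if b = j then 0 else if b \<in> S then - 1 else 1))"
proof -
  \<comment> \<open>The cell \<open>(j, j)\<close> occurs both in the row and in the column of
    \<open>j\<close>; since \<open>e j = 0\<close> it contributes nothing.\<close>
  define e where "e b = (if b = j then 0 else if b \<in> S then - 1 else 1 :: int)" for b
  have "crossings F N (insert j S) = crossings F N S +
      ((\<Sum>a = 1..N. \<Sum>b = 1..N. if a = j then F a b * e b else 0) +
       (\<Sum>a = 1..N. \<Sum>b = 1..N. if b = j then F a b * e a else 0))"
    unfolding crossings_def sum.distrib[symmetric]
    by (intro sum.cong refl) (use assms(2) in \<open>auto simp: e_def\<close>)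
  also have "(\<Sum>a = 1..N. \<Sum>b = 1..N. if b = j then F a b * e a else 0) = (\<Sum>a = 1..N. F a j * e a)"
    using assms(1) by simp
  also have "(\<Sum>a = 1..N. \<Sum>b = 1..N. if a = j then F a b * e b else 0) =
      (\<Sum>a = 1..N. if a = j then \<Sum>b = 1..N. F a b * e b else 0)"
    by (intro sum.cong refl) auto
  also have "\<dots> = (\<Sum>b = 1..N. F j b * e b)"
    using assms(1) by simp
  finally show ?thesis
    by (simp add: e_def sum.distrib algebra_simps)
qed

definition interval_weight :: "(int \<Rightarrow> int \<Rightarrow> int) \<Rightarrow> int \<Rightarrow> int \<Rightarrow> int \<Rightarrow> int \<Rightarrow> int" where
  "interval_weight F N x i j = of_bool (x \<in> {i..j}) + crossings F N {i..j}"

lemma interval_weight_empty: "j < i \<Longrightarrow> interval_weight F N x i j = 0"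
  by (simp add: interval_weight_def)

text \<open>The summand of \<open>crossings_insert\<close> for \<open>S = {i..j - 1}\<close>,
  expressed by the index comparisons that the machine performs; the value 0 remains for
  \<open>b = j\<close>.\<close>

definition crossing_gain :: "(int \<Rightarrow> int \<Rightarrow> int) \<Rightarrow> int \<Rightarrow> int \<Rightarrow> int \<Rightarrow> int" where
  "crossing_gain F i j b =
     (if b < i \<or> j < b then F j b + F b j else if b < j then - (F j b + F b j) else 0)"

text \<open>A single pass over the keys replaces the double sum of \<open>crossings\<close>. Started
  at the empty interval, it yields the weights of a row in O(n) per entry.\<close>

lemma interval_weight_extend:
  assumes "1 \<le> i" "i \<le> j" "j \<le> N"
  shows "interval_weight F N x i j =
    interval_weight F N x i (j - 1) + (\<Sum>b = 1..N. crossing_gain F i j b) + of_bool (x = j)"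
proof -
  have "{i..j} = insert j {i..j - 1}"
    using assms by auto
  moreover have "(\<Sum>b = 1..N. (F j b + F b j) * (if b = j then 0 else if b \<in> {i..j - 1} then - 1 else 1))
      = (\<Sum>b = 1..N. crossing_gain F i j b)"
    by (intro sum.cong refl) (use assms in \<open>auto simp: crossing_gain_def\<close>)
  ultimately have "crossings F N {i..j} = crossings F N {i..j - 1} + (\<Sum>b = 1..N. crossing_gain F i j b)"
    using crossings_insert[of j N "{i..j - 1}" F] assms by simp
  then show ?thesis
    using assms by (auto simp: interval_weight_def)
qed

section \<open>Tables of optimal subtrees\<close>

text \<open>The search tree order splits an interval into intervals, which is why a recursion over
  intervals covers every tree.\<close>

lemma int_image_subtrees:
  assumes "bst \<langle>l, k, r\<rangle>" "int ` set_tree \<langle>l, k, r\<rangle> = {i..j}"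
  shows "int k \<in> {i..j}" "int ` set_tree l = {i..int k - 1}" "int ` set_tree r = {int k + 1..j}"
proof -
  have lk: "\<forall>x\<in>set_tree l. x < k" and rk: "\<forall>x\<in>set_tree r. k < x"
    using assms(1) by auto
  show k: "int k \<in> {i..j}"
    using assms(2) by auto
  have "int ` set_tree l = {x \<in> int ` set_tree \<langle>l, k, r\<rangle>. x < int k}"
    using lk rk by auto
  also have "\<dots> = {i..int k - 1}"
    using k unfolding assms(2) by auto
  finally show "int ` set_tree l = {i..int k - 1}" .
  have "int ` set_tree r = {x \<in> int ` set_tree \<langle>l, k, r\<rangle>. int k < x}"
    using lk rk by auto
  also have "\<dots> = {int k + 1..j}"
    using k unfolding assms(2) by auto
  finally show "int ` set_tree r = {int k + 1..j}" .
qed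

text \<open>The Bellman equation at one entry, with \<open>K\<close> as the witness of the
  minimum.\<close>

definition optimal_entry ::
  "(int \<Rightarrow> int \<Rightarrow> int) \<Rightarrow> (int \<Rightarrow> int \<Rightarrow> int) \<Rightarrow> (int \<Rightarrow> int \<Rightarrow> int) \<Rightarrow> int \<Rightarrow> int \<Rightarrow> bool" where
  "optimal_entry w C K i j \<longleftrightarrow>
     K i j \<in> {i..j} \<and> C i j = w i j + C i (K i j - 1) + C (K i j + 1) j \<and>
     (\<forall>k\<in>{i..j}. C i j \<le> w i j + C i (k - 1) + C (k + 1) j)"

text \<open>Entries with \<open>j < i\<close> stand for empty intervals: 0 is the cost of the empty
  tree in \<open>C\<close> and the null pointer in \<open>K\<close>. As arrays are initially 0, the
  program never writes these entries.\<close>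

definition zero_below_diagonal :: "(int \<Rightarrow> int \<Rightarrow> int) \<Rightarrow> bool" where
  "zero_below_diagonal C \<longleftrightarrow> (\<forall>i j. j < i \<longrightarrow> C i j = 0)"

section \<open>Search paths in the table of roots\<close>

definition descend :: "(int \<Rightarrow> int \<Rightarrow> int) \<Rightarrow> int \<Rightarrow> int \<times> int \<Rightarrow> int \<times> int" where
  "descend K k = (\<lambda>(i, j).
     if k < K i j then (i, K i j - 1) else if K i j < k then (K i j + 1, j) else (i, j))"

text \<open>\<open>descend\<close> stays put once \<open>k\<close> is the root of the interval, so
  the path can be the set of all iterates, with no stopping rule.\<close>

definition search_path :: "(int \<Rightarrow> int \<Rightarrow> int) \<Rightarrow> int \<Rightarrow> int \<Rightarrow> (int \<times> int) set" where
  "search_path K N k = range (\<lambda>m. (descend K k ^^ m) (1, N))"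

lemma search_path_start: "(1, N) \<in> search_path K N k"
  unfolding search_path_def by (rule range_eqI[of _ _ 0]) simp

lemma search_path_descend: "p \<in> search_path K N k \<Longrightarrow> descend K k p \<in> search_path K N k"
  unfolding search_path_def
proof (elim rangeE)
  fix m assume "p = (descend K k ^^ m) (1, N)"
  then have "descend K k p = (descend K k ^^ Suc m) (1, N)" by simp
  then show "descend K k p \<in> range (\<lambda>m. (descend K k ^^ m) (1, N))" by (rule range_eqI)
qed

text \<open>The iteration is stationary from the first interval with root \<open>k\<close> on, so of
  two such intervals the one reached earlier equals the other. Hence the interval at which the
  machine stops is the one meant in \<open>linked\<close>.\<close>

lemma search_path_end_unique:
  assumes "(i, j) \<in> search_path K N k" "K i j = k" "(i', j') \<in> search_path K N k" "K i' j' = k"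
  shows "i' = i \<and> j' = j"
proof -
  have fixed: "(descend K k ^^ d) p = p" if "K (fst p) (snd p) = k" for d p
    using that by (induction d) (auto simp: descend_def split: prod.splits)
  have *: "p = q" if "p = (descend K k ^^ m) (1, N)" "q = (descend K k ^^ m') (1, N)" "m \<le> m'"
    "K (fst p) (snd p) = k" for p q m m'
  proof -
    have "q = (descend K k ^^ (m' - m)) p"
      unfolding that(1,2) comp_apply[symmetric, of "descend K k ^^ (m' - m)"] funpow_add[symmetric]
      using that(3) by simp
    then show ?thesis using fixed[OF that(4)] by simp
  qed
  obtain m m' where "(i, j) = (descend K k ^^ m) (1, N)" "(i', j') = (descend K k ^^ m') (1, N)"
    using assms(1,3) unfolding search_path_def image_iff by blast
  then have "(i, j) = (i', j')"
    using *[of "(i, j)" m "(i', j')" m'] *[of "(i', j')" m' "(i, j)" m] assms(2,4) nat_le_linear[of m m']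
    by (metis fst_conv snd_conv)
  then show ?thesis by simp
qed

definition linked :: "(int \<Rightarrow> int \<Rightarrow> int) \<Rightarrow> int \<Rightarrow> store \<Rightarrow> int \<Rightarrow> bool" where
  "linked K N s k \<longleftrightarrow> (\<forall>i j. (i, j) \<in> search_path K N k \<and> K i j = k \<longrightarrow>
     arr s ''left'' k 0 = K i (k - 1) \<and> arr s ''right'' k 0 = K (k + 1) j)"

section \<open>From local optimality of the entries to an optimal tree\<close>

locale optimal_tables =
  fixes w C K :: "int \<Rightarrow> int \<Rightarrow> int" and N :: int
  assumes entry: "\<And>i j. 1 \<le> i \<Longrightarrow> i \<le> j \<Longrightarrow> j \<le> N \<Longrightarrow> optimal_entry w C K i j"
    and C_zero: "zero_below_diagonal C" and K_zero: "zero_below_diagonal K"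
begin

text \<open>Induction on the competing tree: its root is one of the candidates in the Bellman
  inequality, and its subtrees compete on the two remaining intervals.\<close>

lemma cost_lower_bound:
  assumes "bst T" "int ` set_tree T = {i..j}" "1 \<le> i" "j \<le> N"
    and "\<And>i j S. int ` S = {i..j} \<Longrightarrow> i \<le> j \<Longrightarrow> W S = w i j"
  shows "C i j \<le> node_sum W T"
  using assms(1-4)
proof (induction T arbitrary: i j)
  case Leaf
  then show ?case using C_zero by (simp add: zero_below_diagonal_def)
next
  case (Node l k r)
  note sub = int_image_subtrees[OF Node.prems(1,2)]
  have "C i (int k - 1) \<le> node_sum W l" "C (int k + 1) j \<le> node_sum W r"
    using Node.prems sub by (auto intro!: Node.IH)
  moreover have "W (set_tree \<langle>l, k, r\<rangle>) = w i j"
    using assms(5)[OF Node.prems(2)] sub(1) by simp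
  moreover have "C i j \<le> w i j + C i (int k - 1) + C (int k + 1) j"
    using entry[of i j] sub(1) Node.prems(3,4) unfolding optimal_entry_def by auto
  ultimately show ?case by simp
qed

text \<open>The tree and its pointer representation are built together. The assumption on search
  paths passes to each subinterval because all its keys branch to the same side at the root
  \<open>K i j\<close>.\<close>

lemma optimal_tree_exists:
  assumes "1 \<le> i" "j \<le> N" "\<And>k. k \<in> {i..j} \<Longrightarrow> (i, j) \<in> search_path K N k"
    and W: "\<And>i j S. int ` S = {i..j} \<Longrightarrow> i \<le> j \<Longrightarrow> W S = w i j"
    and links: "\<And>k. k \<in> {1..N} \<Longrightarrow> linked K N s k"
  shows "\<exists>T. bst T \<and> int ` set_tree T = {i..j} \<and> node_sum W T = C i j \<and> tree_at s (K i j) T"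
  using assms(1-3)
\<comment> \<open>The measure is the number of keys; unlike \<open>nat (j - i)\<close> it also
  decreases from a single key to an empty interval.\<close>
proof (induction "nat (j + 1 - i)" arbitrary: i j rule: less_induct)
  case less
  show ?case
  proof (cases "i \<le> j")
    case False
    then show ?thesis
      using C_zero K_zero by (intro exI[of _ Leaf]) (simp add: zero_below_diagonal_def)
  next
    case True
    define k where "k = K i j"
    have k: "i \<le> k" "k \<le> j" "C i j = w i j + C i (k - 1) + C (k + 1) j"
      using entry[of i j] True less.prems unfolding optimal_entry_def k_def by auto
    have "(i, k - 1) \<in> search_path K N x" if "x \<in> {i..k - 1}" for x
      using search_path_descend[OF less.prems(3), of x] that k(1,2) by (auto simp: descend_def k_def)
    then have "\<exists>T. bst T \<and> int ` set_tree T = {i..k - 1} \<and> node_sum W T = C i (k - 1) \<and>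
        tree_at s (K i (k - 1)) T"
      using less.prems(1,2) k(1,2) by (intro less.hyps) auto
    then obtain l where l: "bst l" "int ` set_tree l = {i..k - 1}" "node_sum W l = C i (k - 1)"
      "tree_at s (K i (k - 1)) l" by blast
    have "(k + 1, j) \<in> search_path K N x" if "x \<in> {k + 1..j}" for x
      using search_path_descend[OF less.prems(3), of x] that k(1,2) by (auto simp: descend_def k_def)
    then have "\<exists>T. bst T \<and> int ` set_tree T = {k + 1..j} \<and> node_sum W T = C (k + 1) j \<and>
        tree_at s (K (k + 1) j) T"
      using less.prems(1,2) k(1,2) by (intro less.hyps) auto
    then obtain r where r: "bst r" "int ` set_tree r = {k + 1..j}" "node_sum W r = C (k + 1) j"
      "tree_at s (K (k + 1) j) r" by blast
    have ptr: "arr s ''left'' k 0 = K i (k - 1) \<and> arr s ''right'' k 0 = K (k + 1) j"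
    proof -
      have "(i, j) \<in> search_path K N k" using k(1,2) by (intro less.prems(3)) simp
      moreover have "linked K N s k" using k(1,2) less.prems(1,2) by (intro links) simp
      ultimately show ?thesis using k_def unfolding linked_def by blast
    qed
    have "x < nat k" if "x \<in> set_tree l" for x
    proof -
      have "int x \<in> {i..k - 1}" using that l(2) by blast
      then show ?thesis by auto
    qed
    moreover have "nat k < x" if "x \<in> set_tree r" for x
    proof -
      have "int x \<in> {k + 1..j}" using that r(2) by blast
      then show ?thesis using k(1) less.prems(1) by auto
    qed
    ultimately have "bst \<langle>l, nat k, r\<rangle>"
      using l(1) r(1) by auto
    moreover have set: "int ` set_tree \<langle>l, nat k, r\<rangle> = {i..j}"
      using l(2) r(2) k(1,2) less.prems(1) by (auto simp: image_Un)
    moreover have "node_sum W \<langle>l, nat k, r\<rangle> = C i j"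
      using W[OF set True] l(3) r(3) k(3) by simp
    moreover have "tree_at s (K i j) \<langle>l, nat k, r\<rangle>"
      using l(4) r(4) k(1) less.prems(1) ptr by (simp flip: k_def)
    ultimately show ?thesis by blast
  qed
qed

end

section \<open>Time-bounded execution\<close>

text \<open>Total correctness with a time budget. One halting run suffices because
  \<open>exec\<close> is deterministic.\<close>

definition runs :: "com \<Rightarrow> store \<Rightarrow> nat \<Rightarrow> (store \<Rightarrow> bool) \<Rightarrow> bool" where
  "runs c s t Q \<longleftrightarrow> (\<exists>k s'. exec c s k s' \<and> k \<le> t \<and> Q s')"

lemma runs_mono:
  assumes "runs c s t Q" "\<And>s'. Q s' \<Longrightarrow> R s'" "t \<le> u"
  shows "runs c s u R"
  using assms unfolding runs_def by (meson order_trans)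

lemma runs_Seq:
  assumes "runs c s t Q" "\<And>s'. Q s' \<Longrightarrow> runs d s' u R" "t + u \<le> v"
  shows "runs (Seq c d) s v R"
proof -
  obtain k s' where "exec c s k s'" "k \<le> t" "Q s'"
    using assms(1) unfolding runs_def by blast
  moreover obtain k' s'' where "exec d s' k' s''" "k' \<le> u" "R s''"
    using assms(2)[OF \<open>Q s'\<close>] unfolding runs_def by blast
  ultimately show ?thesis
    unfolding runs_def using exec.Seq[of c s k s' d k' s''] assms(3) by fastforce
qed

text \<open>The variant limits the number of rounds to \<open>m\<close>; the summand outside the
  product pays for the last, failing test.\<close>

lemma runs_While:
  fixes V :: "store \<Rightarrow> nat"
  assumes body: "\<And>s. I s \<Longrightarrow> bval b s \<Longrightarrow> runs c s t (\<lambda>s'. I s' \<and> V s' < V s)"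
    and "I s" "V s \<le> m" "m * (1 + btime b + t) + (1 + btime b) \<le> u"
    and "\<And>s'. I s' \<Longrightarrow> \<not> bval b s' \<Longrightarrow> Q s'"
  shows "runs (WHILE b c) s u Q"
proof -
  have "runs (WHILE b c) s (m * (1 + btime b + t) + (1 + btime b)) Q"
    using assms(2,3)
  proof (induction m arbitrary: s)
    case (0 s)
    \<comment> \<open>A variant of 0 cannot decrease, so a true guard would contradict
      \<open>body\<close>.\<close>
    then have "\<not> bval b s"
      using body[of s] unfolding runs_def by auto
    then show ?case
      unfolding runs_def using exec.WhileFalse[of b s c] assms(5) 0 by auto
  next
    case (Suc m s)
    show ?case
    proof (cases "bval b s")
      case False
      then show ?thesis
        unfolding runs_def using exec.WhileFalse[of b s c] assms(5) Suc.prems by fastforce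
    next
      case True
      obtain k s' where k: "exec c s k s'" "k \<le> t" "I s'" "V s' < V s"
        using body[OF Suc.prems(1) True] unfolding runs_def by blast
      obtain k' s'' where k': "exec (WHILE b c) s' k' s''"
        "k' \<le> m * (1 + btime b + t) + (1 + btime b)" "Q s''"
        using Suc.IH[of s'] k Suc.prems(2) unfolding runs_def by auto
      have "exec (WHILE b c) s (1 + btime b + k + k') s''"
        using exec.WhileTrue[OF True k(1) k'(1)] .
      moreover have "1 + btime b + k + k' \<le> Suc m * (1 + btime b + t) + (1 + btime b)"
        using k(2) k'(2) by simp
      ultimately show ?thesis
        unfolding runs_def using k'(3) by blast
    qed
  qed
  then show ?thesis
    by (rule runs_mono) (use assms(4) in auto)
qed

text \<open>For code without loops, the simplifier can compute the final store and a time bound, so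
  only loops need invariants. The values of \<open>result\<close> and \<open>max_time\<close> at
  \<open>WHILE\<close> are dummies excluded by this predicate.\<close>

primrec loop_free :: "com \<Rightarrow> bool" where
  "loop_free SKIP \<longleftrightarrow> True"
| "loop_free (Assign x a) \<longleftrightarrow> True"
| "loop_free (Put A i j a) \<longleftrightarrow> True"
| "loop_free (Seq c d) \<longleftrightarrow> loop_free c \<and> loop_free d"
| "loop_free (IF b c d) \<longleftrightarrow> loop_free c \<and> loop_free d"
| "loop_free (WHILE b c) \<longleftrightarrow> False"

primrec result :: "com \<Rightarrow> store \<Rightarrow> store" where
  "result SKIP s = s"
| "result (Assign x a) s = s\<lparr>var := (var s)(x := aval a s)\<rparr>"
| "result (Put A i j a) s = put A (aval i s) (aval j s) (aval a s) s"
| "result (Seq c d) s = result d (result c s)"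
| "result (IF b c d) s = (if bval b s then result c s else result d s)"
| "result (WHILE b c) s = s"

primrec max_time :: "com \<Rightarrow> nat" where
  "max_time SKIP = 1"
| "max_time (Assign x a) = 1 + atime a"
| "max_time (Put A i j a) = 1 + atime i + atime j + atime a"
| "max_time (Seq c d) = max_time c + max_time d"
| "max_time (IF b c d) = 1 + btime b + max (max_time c) (max_time d)"
| "max_time (WHILE b c) = 0"

lemma exec_loop_free:
  "loop_free c \<Longrightarrow> \<exists>k \<le> max_time c. exec c s k (result c s)"
proof (induction c arbitrary: s)
  case (Seq c d)
  then obtain k k' where "k \<le> max_time c" "exec c s k (result c s)"
    "k' \<le> max_time d" "exec d (result c s) k' (result d (result c s))"
    by (metis loop_free.simps(4))
  then show ?case
    by (intro exI[of _ "k + k'"]) (auto intro: exec.Seq)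
next
  case (IF b c d)
  show ?case
  proof (cases "bval b s")
    case True
    then obtain k where "k \<le> max_time c" "exec c s k (result c s)"
      using IF by (metis loop_free.simps(5))
    then show ?thesis
      using True exec.IfTrue[OF True, of c k _ d] by (intro exI[of _ "1 + btime b + k"]) auto
  next
    case False
    then obtain k where "k \<le> max_time d" "exec d s k (result d s)"
      using IF by (metis loop_free.simps(5))
    then show ?thesis
      using False exec.IfFalse[OF False, of d k _ c] by (intro exI[of _ "1 + btime b + k"]) auto
  qed
qed (use exec.Skip exec.Assign exec.Put in fastforce)+

lemma runs_loop_free: "loop_free c \<Longrightarrow> Q (result c s) \<Longrightarrow> max_time c \<le> t \<Longrightarrow> runs c s t Q"
  unfolding runs_def using exec_loop_free[of c s] by (meson order_trans)

abbreviation Seq_infix :: "com \<Rightarrow> com \<Rightarrow> com" (infixr ";;" 60) where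
  "c ;; d \<equiv> Seq c d"

abbreviation Le :: "aexp \<Rightarrow> aexp \<Rightarrow> bexp" where
  "Le a b \<equiv> Neg (Less b a)"

abbreviation Eq :: "aexp \<Rightarrow> aexp \<Rightarrow> bexp" where
  "Eq a b \<equiv> Conj (Neg (Less a b)) (Neg (Less b a))"

abbreviation Incr :: "vname \<Rightarrow> com" where
  "Incr x \<equiv> Assign x (Plus (Var x) (Num 1))"

text \<open>The variables form a list so that the simplifier splits the condition into finitely many equations.\<close>

definition keeps :: "vname list \<Rightarrow> store \<Rightarrow> store \<Rightarrow> bool" where
  "keeps U s s' \<longleftrightarrow> list_all (\<lambda>x. var s' x = var s x) U"

lemma keeps_simps [simp]:
  "keeps [] s s' \<longleftrightarrow> True"
  "keeps (x # U) s s' \<longleftrightarrow> var s' x = var s x \<and> keeps U s s'"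
  by (simp_all add: keeps_def)

lemma sum_int_upto: "1 \<le> b \<Longrightarrow> sum g {1..b} = sum g {1..b - 1} + g b" for b :: int
proof -
  assume "1 \<le> b"
  then have "{1..b} = insert b {1..b - 1}" by auto
  then show ?thesis by (simp add: add.commute)
qed

section \<open>The program\<close>

definition balance_loop :: com where
  "balance_loop = WHILE (Le (Var ''b'') (Var ''n''))
     (Assign ''d'' (Plus (Var ''d'')
        (Minus (Get ''f'' (Var ''a'') (Var ''b'')) (Get ''f'' (Var ''b'') (Var ''a'')))) ;;
      Incr ''b'')"

lemma runs_balance_loop:
  assumes "var s ''n'' = int n" "var s ''b'' = 1" "var s ''d'' = 0"
  shows "runs balance_loop s (20 * n + 20) (\<lambda>s'. arr s' = arr s \<and> keeps [''n'', ''a'', ''first''] s s' \<and>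
    var s' ''d'' = (\<Sum>b = 1..int n. arr s ''f'' (var s ''a'') b - arr s ''f'' b (var s ''a'')))"
proof -
  define g where "g b = arr s ''f'' (var s ''a'') b - arr s ''f'' b (var s ''a'')" for b
  define I where "I s' \<longleftrightarrow> arr s' = arr s \<and> keeps [''n'', ''a'', ''first''] s s' \<and> var s' ''b'' \<in> {1..int n + 1} \<and>
    var s' ''d'' = sum g {1..var s' ''b'' - 1}" for s'
  show ?thesis
    unfolding balance_loop_def
  \<comment> \<open>14 is the \<open>max_time\<close> of the body: 10 for the update of
    \<open>d\<close> and 4 for the increment. The test adds 5 per round, giving
    \<open>19 * n + 5\<close>; the stated bounds are rounded up here and below.\<close>
  proof (rule runs_While[where I = I and V = "\<lambda>s'. nat (int n + 1 - var s' ''b'')" and m = n and t = 14])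
    show "I s" using assms by (simp add: I_def)
  next
    fix s' assume "I s'" "bval (Le (Var ''b'') (Var ''n'')) s'"
    then show "runs (Assign ''d'' (Plus (Var ''d'')
        (Minus (Get ''f'' (Var ''a'') (Var ''b'')) (Get ''f'' (Var ''b'') (Var ''a'')))) ;;
        Incr ''b'') s' 14 (\<lambda>s''. I s'' \<and> nat (int n + 1 - var s'' ''b'') < nat (int n + 1 - var s' ''b''))"
      using assms by (intro runs_loop_free) (simp_all add: I_def sum_int_upto[of "var s' ''b''"] g_def)
  next
    fix s' assume "I s'" "\<not> bval (Le (Var ''b'') (Var ''n'')) s'"
    moreover from this have "var s' ''b'' = int n + 1"
      using assms by (simp add: I_def)
    ultimately show "arr s' = arr s \<and> keeps [''n'', ''a'', ''first''] s s' \<and>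
      var s' ''d'' = (\<Sum>b = 1..int n. arr s ''f'' (var s ''a'') b - arr s ''f'' b (var s ''a''))"
      by (simp add: I_def g_def)
  qed (use assms in auto)
qed

definition find_first :: com where
  "find_first = Assign ''a'' (Num 1) ;; WHILE (Le (Var ''a'') (Var ''n''))
     ((Assign ''b'' (Num 1) ;; Assign ''d'' (Num 0)) ;; balance_loop ;;
      IF (Less (Num 0) (Var ''d'')) (Assign ''first'' (Var ''a'')) SKIP ;; Incr ''a'')"

text \<open>Here \<open>x\<close> and \<open>y\<close> stand for the first and last key. If they
  differ, the balance is positive exactly at \<open>x\<close>; if they agree, it is positive
  nowhere, and \<open>first\<close> keeps its input value.\<close>

lemma runs_find_first:
  assumes "var s ''n'' = int n"
    and bal: "\<And>a. a \<in> {1..int n} \<Longrightarrow>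
      (\<Sum>b = 1..int n. arr s ''f'' a b - arr s ''f'' b a) = of_bool (x = a) - of_bool (y = a)"
    and "x \<in> {1..int n}" "x = y \<Longrightarrow> var s ''first'' = x"
  shows "runs find_first s (60 * (n + 1) ^ 2) (\<lambda>s'. arr s' = arr s \<and> keeps [''n''] s s' \<and>
    var s' ''first'' = x)"
proof -
  define I where "I s' \<longleftrightarrow> arr s' = arr s \<and> keeps [''n''] s s' \<and> var s' ''a'' \<in> {1..int n + 1} \<and>
    var s' ''first'' = (if x \<noteq> y \<and> x < var s' ''a'' then x else var s ''first'')" for s'
  show ?thesis
    unfolding find_first_def
  proof (rule runs_Seq[where Q = I and t = 2 and u = "60 * (n + 1) ^ 2 - 2"])
    show "runs (Assign ''a'' (Num 1)) s 2 I"
      by (rule runs_loop_free) (use assms(3) in \<open>auto simp: I_def\<close>)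
  next
    fix s0 assume "I s0"
    show "runs (WHILE (Le (Var ''a'') (Var ''n''))
     ((Assign ''b'' (Num 1) ;; Assign ''d'' (Num 0)) ;; balance_loop ;;
      IF (Less (Num 0) (Var ''d'')) (Assign ''first'' (Var ''a'')) SKIP ;; Incr ''a'')) s0 (60 * (n + 1) ^ 2 - 2)
      (\<lambda>s'. arr s' = arr s \<and> keeps [''n''] s s' \<and> var s' ''first'' = x)"
    proof (rule runs_While[where I = I and V = "\<lambda>s'. nat (int n + 1 - var s' ''a'')" and m = n and t = "20 * n + 40"])
      fix s' assume I: "I s'" and b: "bval (Le (Var ''a'') (Var ''n'')) s'"
      show "runs ((Assign ''b'' (Num 1) ;; Assign ''d'' (Num 0)) ;; balance_loop ;;
        IF (Less (Num 0) (Var ''d'')) (Assign ''first'' (Var ''a'')) SKIP ;; Incr ''a'') s' (20 * n + 40)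
        (\<lambda>s''. I s'' \<and> nat (int n + 1 - var s'' ''a'') < nat (int n + 1 - var s' ''a''))"
      proof (rule runs_Seq[where t = 4 and u = "20 * n + 36"
          and Q = "\<lambda>s1. arr s1 = arr s' \<and> keeps [''n'', ''a'', ''first''] s' s1 \<and> var s1 ''b'' = 1 \<and> var s1 ''d'' = 0"])
        fix s1 assume s1: "arr s1 = arr s' \<and> keeps [''n'', ''a'', ''first''] s' s1 \<and> var s1 ''b'' = 1 \<and> var s1 ''d'' = 0"
        show "runs (balance_loop ;;
            IF (Less (Num 0) (Var ''d'')) (Assign ''first'' (Var ''a'')) SKIP ;; Incr ''a'') s1 (20 * n + 36)
            (\<lambda>s''. I s'' \<and> nat (int n + 1 - var s'' ''a'') < nat (int n + 1 - var s' ''a''))"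
        proof (rule runs_Seq[OF runs_balance_loop[of _ n], where u = 16])
          fix s2 assume s2: "arr s2 = arr s1 \<and> keeps [''n'', ''a'', ''first''] s1 s2 \<and> var s2 ''d'' =
              (\<Sum>b = 1..int n. arr s1 ''f'' (var s1 ''a'') b - arr s1 ''f'' b (var s1 ''a''))"
          have "var s2 ''d'' = of_bool (x = var s' ''a'') - of_bool (y = var s' ''a'')"
            using s2 s1 I b bal[of "var s' ''a''"] assms(1) by (simp add: I_def)
          then show "runs (IF (Less (Num 0) (Var ''d'')) (Assign ''first'' (Var ''a'')) SKIP ;; Incr ''a'')
              s2 16 (\<lambda>s''. I s'' \<and> nat (int n + 1 - var s'' ''a'') < nat (int n + 1 - var s' ''a''))"
            using s1 s2 I b assms(1)
            by (intro runs_loop_free) (auto simp: I_def split: if_splits)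
        qed (use s1 I assms(1) in \<open>auto simp: I_def\<close>)
      qed (auto intro!: runs_loop_free)
    next
      fix s' assume "I s'" "\<not> bval (Le (Var ''a'') (Var ''n'')) s'"
      moreover from this have "var s' ''a'' = int n + 1"
        using assms by (simp add: I_def)
      ultimately show "arr s' = arr s \<and> keeps [''n''] s s' \<and> var s' ''first'' = x"
        using assms(3,4) by (auto simp: I_def)
    qed (use \<open>I s0\<close> in \<open>auto simp: I_def power2_eq_square algebra_simps\<close>)
  qed (auto simp: power2_eq_square)
qed

section \<open>Weight and best root of one interval\<close>

definition gain_step :: com where
  "gain_step =
     (let add = Assign ''w'' (Plus (Var ''w'')
            (Plus (Get ''f'' (Var ''j'') (Var ''b'')) (Get ''f'' (Var ''b'') (Var ''j''))));
          subtract = Assign ''w'' (Minus (Var ''w'')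
            (Plus (Get ''f'' (Var ''j'') (Var ''b'')) (Get ''f'' (Var ''b'') (Var ''j''))))
      in IF (Less (Var ''b'') (Var ''i'')) add
           (IF (Less (Var ''j'') (Var ''b'')) add
             (IF (Less (Var ''b'') (Var ''j'')) subtract SKIP)) ;;
         Incr ''b'')"

definition gain_loop :: com where
  "gain_loop = WHILE (Le (Var ''b'') (Var ''n'')) gain_step"

lemma runs_gain_loop:
  assumes "var s ''n'' = int n" "var s ''b'' = 1"
  shows "runs gain_loop s (40 * n + 10) (\<lambda>s'. arr s' = arr s \<and> keeps [''n'', ''first'', ''i'', ''j''] s s' \<and>
    var s' ''w'' = var s ''w'' + (\<Sum>b = 1..int n. crossing_gain (arr s ''f'') (var s ''i'') (var s ''j'') b))"
proof -
  define g where "g = crossing_gain (arr s ''f'') (var s ''i'') (var s ''j'')"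
  define I where "I s' \<longleftrightarrow> arr s' = arr s \<and> keeps [''n'', ''first'', ''i'', ''j''] s s' \<and>
    var s' ''b'' \<in> {1..int n + 1} \<and> var s' ''w'' = var s ''w'' + sum g {1..var s' ''b'' - 1}" for s'
  show ?thesis
    unfolding gain_loop_def
  proof (rule runs_While[where I = I and V = "\<lambda>s'. nat (int n + 1 - var s' ''b'')" and m = n and t = 26])
    show "I s" using assms by (simp add: I_def)
  next
    fix s' assume "I s'" "bval (Le (Var ''b'') (Var ''n'')) s'"
    then show "runs gain_step s' 26
        (\<lambda>s''. I s'' \<and> nat (int n + 1 - var s'' ''b'') < nat (int n + 1 - var s' ''b''))"
      unfolding gain_step_def Let_def using assms
      by (intro runs_loop_free)
        (auto simp: I_def sum_int_upto[of "var s' ''b''"] g_def crossing_gain_def)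
  next
    fix s' assume "I s'" "\<not> bval (Le (Var ''b'') (Var ''n'')) s'"
    moreover from this have "var s' ''b'' = int n + 1"
      using assms by (simp add: I_def)
    ultimately show "arr s' = arr s \<and> keeps [''n'', ''first'', ''i'', ''j''] s s' \<and>
      var s' ''w'' = var s ''w'' + (\<Sum>b = 1..int n. crossing_gain (arr s ''f'') (var s ''i'') (var s ''j'') b)"
      by (simp add: I_def g_def)
  qed (use assms in auto)
qed

definition min_step :: com where
  "min_step = Assign ''c'' (Plus (Get ''C'' (Var ''i'') (Minus (Var ''k'') (Num 1)))
                                 (Get ''C'' (Plus (Var ''k'') (Num 1)) (Var ''j''))) ;;
     IF (Less (Var ''c'') (Var ''m'')) (Assign ''m'' (Var ''c'') ;; Assign ''r'' (Var ''k'')) SKIP ;;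
     Incr ''k''"

definition min_loop :: com where
  "min_loop = WHILE (Le (Var ''k'') (Var ''j'')) min_step"

text \<open>The candidate \<open>i\<close> is evaluated before the loop, so the minimum needs no
  infinite initial value. \<open>V\<close> omits the weight of the interval, which is common to all
  candidates and is added when the entry is stored.\<close>

lemma runs_min_loop:
  assumes "1 \<le> var s ''i''" "var s ''i'' \<le> var s ''j''" "var s ''j'' \<le> int n"
    and "var s ''k'' = var s ''i'' + 1" "var s ''r'' = var s ''i''"
    and V: "\<And>k. V k = arr s ''C'' (var s ''i'') (k - 1) + arr s ''C'' (k + 1) (var s ''j'')"
    and "var s ''m'' = V (var s ''i'')"
  shows "runs min_loop s (30 * n + 10) (\<lambda>s'. arr s' = arr s \<and>
    keeps [''n'', ''first'', ''i'', ''j'', ''w''] s s' \<and> var s' ''r'' \<in> {var s ''i''..var s ''j''} \<and>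
    var s' ''m'' = V (var s' ''r'') \<and> (\<forall>k\<in>{var s ''i''..var s ''j''}. var s' ''m'' \<le> V k))"
proof -
  define I where "I s' \<longleftrightarrow> arr s' = arr s \<and> keeps [''n'', ''first'', ''i'', ''j'', ''w''] s s' \<and>
    var s' ''k'' \<in> {var s ''i''..var s ''j'' + 1} \<and>
    var s' ''r'' \<in> {var s ''i''..var s ''j''} \<and> var s' ''m'' = V (var s' ''r'') \<and>
    (\<forall>k\<in>{var s ''i''..<var s' ''k''}. var s' ''m'' \<le> V k)" for s'
  show ?thesis
    unfolding min_loop_def
  proof (rule runs_While[where I = I and V = "\<lambda>s'. nat (var s ''j'' + 1 - var s' ''k'')" and m = n and t = 24])
    show "I s" using assms by (auto simp: I_def)
  next
    fix s' assume s': "I s'" "bval (Le (Var ''k'') (Var ''j'')) s'"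
    have *: "{var s ''i''..<var s' ''k'' + 1} = insert (var s' ''k'') {var s ''i''..<var s' ''k''}"
      using s' by (auto simp: I_def)
    show "runs min_step s' 24
        (\<lambda>s''. I s'' \<and> nat (var s ''j'' + 1 - var s'' ''k'') < nat (var s ''j'' + 1 - var s' ''k''))"
      unfolding min_step_def using s'
      by (intro runs_loop_free) (auto simp: V[of "var s' ''k''"] * I_def)
  next
    fix s' assume "I s'" "\<not> bval (Le (Var ''k'') (Var ''j'')) s'"
    moreover from this have "var s' ''k'' = var s ''j'' + 1"
      using assms by (simp add: I_def)
    ultimately show "arr s' = arr s \<and>
      keeps [''n'', ''first'', ''i'', ''j'', ''w''] s s' \<and> var s' ''r'' \<in> {var s ''i''..var s ''j''} \<and>
      var s' ''m'' = V (var s' ''r'') \<and> (\<forall>k\<in>{var s ''i''..var s ''j''}. var s' ''m'' \<le> V k)"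
      by (auto simp: I_def)
  qed (use assms in auto)
qed


section \<open>Filling the tables\<close>

text \<open>Rows are filled by decreasing \<open>i\<close> and each row by increasing \<open>j\<close>; here \<open>(i, j)\<close> is the next entry.\<close>

definition filled ::
  "(int \<Rightarrow> int \<Rightarrow> int) \<Rightarrow> (int \<Rightarrow> int \<Rightarrow> int) \<Rightarrow> (int \<Rightarrow> int \<Rightarrow> int) \<Rightarrow> int \<Rightarrow> int \<Rightarrow> int \<Rightarrow> bool" where
  "filled w C K N i j \<longleftrightarrow> zero_below_diagonal C \<and> zero_below_diagonal K \<and>
     (\<forall>i' j'. i' \<le> j' \<and> j' \<le> N \<and> (i < i' \<or> i' = i \<and> j' < j) \<longrightarrow> optimal_entry w C K i' j')"

lemma optimal_entry_cong:
  assumes "K' i j = K i j" "C' i j = C i j"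
    and "\<And>k. k \<in> {i..j} \<Longrightarrow> C' i (k - 1) = C i (k - 1)"
    and "\<And>k. k \<in> {i..j} \<Longrightarrow> C' (k + 1) j = C (k + 1) j"
  shows "optimal_entry w C' K' i j \<longleftrightarrow> optimal_entry w C K i j"
proof -
  have "(\<forall>k\<in>{i..j}. C' i j \<le> w i j + C' i (k - 1) + C' (k + 1) j) \<longleftrightarrow>
      (\<forall>k\<in>{i..j}. C i j \<le> w i j + C i (k - 1) + C (k + 1) j)"
    by (rule ball_cong) (simp_all only: assms)
  then show ?thesis
    unfolding optimal_entry_def by (metis assms)
qed

text \<open>Row \<open>i\<close> has no entry before column \<open>i\<close>, so completing row
  \<open>i + 1\<close> is the same as having reached the diagonal of row \<open>i\<close>.\<close>

lemma filled_next_row: "filled w C K N (i + 1) (N + 1) \<Longrightarrow> filled w C K N i i"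
  unfolding filled_def
proof (intro conjI allI impI; elim conjE)
  fix i' j'
  assume *: "\<forall>i' j'. i' \<le> j' \<and> j' \<le> N \<and> (i + 1 < i' \<or> i' = i + 1 \<and> j' < N + 1) \<longrightarrow>
      optimal_entry w C K i' j'"
    and "i' \<le> j'" "j' \<le> N" "i < i' \<or> i' = i \<and> j' < i"
  then show "optimal_entry w C K i' j'"
    by (intro *[rule_format]) auto
qed auto

text \<open>An entry depends only on shorter intervals, further left in its row or in rows of larger
  index. In the order of filling, neither a finished entry nor a candidate for the new one reads the
  cell \<open>(i, j)\<close>.\<close>

lemma filled_update:
  assumes fil: "filled w C K N i j" and "i \<le> j" "r \<in> {i..j}"
    and v: "v = w i j + C i (r - 1) + C (r + 1) j"
    and min: "\<forall>k\<in>{i..j}. v \<le> w i j + C i (k - 1) + C (k + 1) j"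
  shows "filled w (C(i := (C i)(j := v))) (K(i := (K i)(j := r))) N i (j + 1)"
    (is "filled w ?C ?K N i (j + 1)")
proof -
  have "optimal_entry w ?C ?K i' j'"
    if ij: "i' \<le> j'" "j' \<le> N" "i < i' \<or> i' = i \<and> j' < j + 1" for i' j'
  proof (cases "i' = i \<and> j' = j")
    case True
    then show ?thesis
      using assms(2-5) by (auto simp: optimal_entry_def)
  next
    case False
    then have "optimal_entry w C K i' j'"
      using fil ij by (auto simp: filled_def)
    moreover have "optimal_entry w ?C ?K i' j' \<longleftrightarrow> optimal_entry w C K i' j'"
      using ij False by (intro optimal_entry_cong) auto
    ultimately show ?thesis by simp
  qed
  then show ?thesis
    using fil assms(2) by (simp add: filled_def zero_below_diagonal_def)
qed

definition cell :: com where
  "cell = Assign ''b'' (Num 1) ;; gain_loop ;;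
     (IF (Eq (Var ''j'') (Var ''first'')) (Incr ''w'') SKIP ;;
      Assign ''m'' (Plus (Get ''C'' (Var ''i'') (Minus (Var ''i'') (Num 1)))
                         (Get ''C'' (Plus (Var ''i'') (Num 1)) (Var ''j''))) ;;
      Assign ''r'' (Var ''i'') ;; Assign ''k'' (Plus (Var ''i'') (Num 1))) ;;
     min_loop ;;
     (Put ''C'' (Var ''i'') (Var ''j'') (Plus (Var ''m'') (Var ''w'')) ;;
      Put ''K'' (Var ''i'') (Var ''j'') (Var ''r'') ;; Incr ''j'')"

text \<open>The variable \<open>w\<close> is carried along the row, from the weight up to
  \<open>j - 1\<close> to the weight up to \<open>j\<close>. The budget is the sum over five phases:
  2, \<open>40 * n + 10\<close>, 34, \<open>30 * n + 10\<close> and 24.\<close>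

lemma runs_cell:
  assumes "var s ''n'' = int n" "1 \<le> var s ''i''" "var s ''i'' \<le> var s ''j''" "var s ''j'' \<le> int n"
    and W: "W = interval_weight (arr s ''f'') (int n) (var s ''first'')"
    and w: "var s ''w'' = W (var s ''i'') (var s ''j'' - 1)"
    and fil: "filled W (arr s ''C'') (arr s ''K'') (int n) (var s ''i'') (var s ''j'')"
  shows "runs cell s (70 * n + 80) (\<lambda>s'. arr s' ''f'' = arr s ''f'' \<and> keeps [''n'', ''first'', ''i''] s s' \<and>
    var s' ''j'' = var s ''j'' + 1 \<and> var s' ''w'' = W (var s ''i'') (var s ''j'') \<and>
    filled W (arr s' ''C'') (arr s' ''K'') (int n) (var s ''i'') (var s ''j'' + 1))"
    (is "runs cell s _ ?Q")
proof -
  define i j where "i = var s ''i''" and "j = var s ''j''"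
  define V where "V k = arr s ''C'' i (k - 1) + arr s ''C'' (k + 1) j" for k
  define Q1 where "Q1 s' \<longleftrightarrow> arr s' = arr s \<and> keeps [''n'', ''first'', ''i'', ''j'', ''w''] s s' \<and>
    var s' ''b'' = 1" for s'
  \<comment> \<open>At this point \<open>w\<close> still lacks the summand of
    \<open>interval_weight_extend\<close> for \<open>x = j\<close>; the test against
    \<open>first\<close> supplies it.\<close>
  define Q2 where "Q2 s' \<longleftrightarrow> arr s' = arr s \<and> keeps [''n'', ''first'', ''i'', ''j''] s s' \<and>
    var s' ''w'' = W i (j - 1) + (\<Sum>b = 1..int n. crossing_gain (arr s ''f'') i j b)" for s'
  define Q3 where "Q3 s' \<longleftrightarrow> arr s' = arr s \<and> keeps [''n'', ''first'', ''i'', ''j''] s s' \<and>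
    var s' ''w'' = W i j \<and> var s' ''m'' = V i \<and> var s' ''r'' = i \<and> var s' ''k'' = i + 1" for s'
  define Q4 where "Q4 s' \<longleftrightarrow> arr s' = arr s \<and> keeps [''n'', ''first'', ''i'', ''j''] s s' \<and>
    var s' ''w'' = W i j \<and> var s' ''r'' \<in> {i..j} \<and> var s' ''m'' = V (var s' ''r'') \<and>
    (\<forall>k\<in>{i..j}. var s' ''m'' \<le> V k)" for s'
  have ij: "1 \<le> i" "i \<le> j" "j \<le> int n"
    using assms by (simp_all add: i_def j_def)
  show ?thesis
    unfolding cell_def
  proof (rule runs_Seq[where Q = Q1 and t = 2 and u = "70 * n + 78"])
    show "runs (Assign ''b'' (Num 1)) s 2 Q1"
      by (rule runs_loop_free) (auto simp: Q1_def)
    fix s1 assume s1: "Q1 s1"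
    show "runs (gain_loop ;;
     (IF (Eq (Var ''j'') (Var ''first'')) (Incr ''w'') SKIP ;;
      Assign ''m'' (Plus (Get ''C'' (Var ''i'') (Minus (Var ''i'') (Num 1)))
                         (Get ''C'' (Plus (Var ''i'') (Num 1)) (Var ''j''))) ;;
      Assign ''r'' (Var ''i'') ;; Assign ''k'' (Plus (Var ''i'') (Num 1))) ;;
     min_loop ;;
     (Put ''C'' (Var ''i'') (Var ''j'') (Plus (Var ''m'') (Var ''w'')) ;;
      Put ''K'' (Var ''i'') (Var ''j'') (Var ''r'') ;; Incr ''j'')) s1 (70 * n + 78) ?Q"
    proof (rule runs_Seq[where Q = Q2 and t = "40 * n + 10" and u = "30 * n + 68"])
      show "runs gain_loop s1 (40 * n + 10) Q2"
        by (rule runs_mono[OF runs_gain_loop])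
          (use s1 assms(1) w in \<open>auto simp: Q1_def Q2_def i_def j_def\<close>)
      fix s2 assume s2: "Q2 s2"
      show "runs ((IF (Eq (Var ''j'') (Var ''first'')) (Incr ''w'') SKIP ;;
        Assign ''m'' (Plus (Get ''C'' (Var ''i'') (Minus (Var ''i'') (Num 1)))
                           (Get ''C'' (Plus (Var ''i'') (Num 1)) (Var ''j''))) ;;
        Assign ''r'' (Var ''i'') ;; Assign ''k'' (Plus (Var ''i'') (Num 1))) ;;
       min_loop ;;
       (Put ''C'' (Var ''i'') (Var ''j'') (Plus (Var ''m'') (Var ''w'')) ;;
        Put ''K'' (Var ''i'') (Var ''j'') (Var ''r'') ;; Incr ''j'')) s2 (30 * n + 68) ?Q"
      proof (rule runs_Seq[where Q = Q3 and t = 34 and u = "30 * n + 34"])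
        show "runs (IF (Eq (Var ''j'') (Var ''first'')) (Incr ''w'') SKIP ;;
          Assign ''m'' (Plus (Get ''C'' (Var ''i'') (Minus (Var ''i'') (Num 1)))
                             (Get ''C'' (Plus (Var ''i'') (Num 1)) (Var ''j''))) ;;
          Assign ''r'' (Var ''i'') ;; Assign ''k'' (Plus (Var ''i'') (Num 1))) s2 34 Q3"
          using s2 interval_weight_extend[OF ij, of "arr s ''f''" "var s ''first''"]
          by (intro runs_loop_free) (auto simp: Q2_def Q3_def V_def W i_def j_def)
        fix s3 assume s3: "Q3 s3"
        show "runs (min_loop ;;
          (Put ''C'' (Var ''i'') (Var ''j'') (Plus (Var ''m'') (Var ''w'')) ;;
           Put ''K'' (Var ''i'') (Var ''j'') (Var ''r'') ;; Incr ''j'')) s3 (30 * n + 34) ?Q"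
        proof (rule runs_Seq[where Q = Q4 and t = "30 * n + 10" and u = 24])
          show "runs min_loop s3 (30 * n + 10) Q4"
            by (rule runs_mono[OF runs_min_loop[where V = V]])
              (use s3 ij in \<open>auto simp: Q3_def Q4_def V_def i_def j_def\<close>)
          fix s4 assume s4: "Q4 s4"
          have "filled W ((arr s ''C'')(i := (arr s ''C'' i)(j := var s4 ''m'' + var s4 ''w'')))
              ((arr s ''K'')(i := (arr s ''K'' i)(j := var s4 ''r''))) (int n) i (j + 1)"
            using s4 fil ij by (intro filled_update) (auto simp: Q4_def V_def i_def j_def)
          then show "runs (Put ''C'' (Var ''i'') (Var ''j'') (Plus (Var ''m'') (Var ''w'')) ;;
             Put ''K'' (Var ''i'') (Var ''j'') (Var ''r'') ;; Incr ''j'') s4 24 ?Q"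
            using s4 by (intro runs_loop_free) (auto simp: Q4_def put_def i_def j_def)
        qed simp
      qed simp
    qed simp
  qed simp
qed

definition row :: com where
  "row = (Assign ''w'' (Num 0) ;; Assign ''j'' (Var ''i'')) ;;
     WHILE (Le (Var ''j'') (Var ''n'')) cell ;; Assign ''i'' (Minus (Var ''i'') (Num 1))"

lemma runs_row:
  assumes "var s ''n'' = int n" "1 \<le> var s ''i''" "var s ''i'' \<le> int n"
    and W: "W = interval_weight (arr s ''f'') (int n) (var s ''first'')"
    and fil: "filled W (arr s ''C'') (arr s ''K'') (int n) (var s ''i'' + 1) (int n + 1)"
  shows "runs row s (100 * (n + 1) ^ 2) (\<lambda>s'. arr s' ''f'' = arr s ''f'' \<and> keeps [''n'', ''first''] s s' \<and>
    var s' ''i'' = var s ''i'' - 1 \<and>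
    filled W (arr s' ''C'') (arr s' ''K'') (int n) (var s ''i'') (int n + 1))"
    (is "runs row s _ ?Q")
proof -
  define i where "i = var s ''i''"
  define I where "I s' \<longleftrightarrow> arr s' ''f'' = arr s ''f'' \<and> keeps [''n'', ''first'', ''i''] s s' \<and>
    var s' ''j'' \<in> {i..int n + 1} \<and> var s' ''w'' = W i (var s' ''j'' - 1) \<and>
    filled W (arr s' ''C'') (arr s' ''K'') (int n) i (var s' ''j'')" for s'
  define J where "J s' \<longleftrightarrow> I s' \<and> var s' ''j'' = int n + 1" for s'
  show ?thesis
    unfolding row_def
  proof (rule runs_Seq[where Q = I and t = 4 and u = "100 * (n + 1) ^ 2 - 4"])
    \<comment> \<open>\<open>w = 0\<close> is the weight of the empty interval
      \<open>{i..i - 1}\<close>, from which the row starts.\<close>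
    show "runs (Assign ''w'' (Num 0) ;; Assign ''j'' (Var ''i'')) s 4 I"
      using filled_next_row[OF fil] assms(2,3) W
      by (intro runs_loop_free) (auto simp: I_def i_def interval_weight_empty)
    fix s1 assume s1: "I s1"
    show "runs (WHILE (Le (Var ''j'') (Var ''n'')) cell ;; Assign ''i'' (Minus (Var ''i'') (Num 1))) s1
      (100 * (n + 1) ^ 2 - 4) ?Q"
    proof (rule runs_Seq[where Q = J and t = "100 * (n + 1) ^ 2 - 8" and u = 4])
      show "runs (WHILE (Le (Var ''j'') (Var ''n'')) cell) s1 (100 * (n + 1) ^ 2 - 8) J"
      proof (rule runs_While[where I = I and V = "\<lambda>s'. nat (int n + 1 - var s' ''j'')" and m = n
            and t = "70 * n + 80"])
        fix s' assume s': "I s'" and b: "bval (Le (Var ''j'') (Var ''n'')) s'"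
        have W': "W = interval_weight (arr s' ''f'') (int n) (var s' ''first'')"
          using s' W by (simp add: I_def)
        show "runs cell s' (70 * n + 80)
            (\<lambda>s''. I s'' \<and> nat (int n + 1 - var s'' ''j'') < nat (int n + 1 - var s' ''j''))"
          by (rule runs_mono[OF runs_cell[OF _ _ _ _ W']])
            (use s' b assms(1,2) in \<open>auto simp: I_def i_def\<close>)
      next
        fix s' assume "I s'" "\<not> bval (Le (Var ''j'') (Var ''n'')) s'"
        then show "J s'" using assms(1) by (auto simp: I_def J_def)
      qed (use s1 assms(2) in \<open>auto simp: I_def i_def power2_eq_square algebra_simps\<close>)
      fix s2 assume "J s2"
      then show "runs (Assign ''i'' (Minus (Var ''i'') (Num 1))) s2 4 ?Q"
        by (intro runs_loop_free) (auto simp: I_def J_def i_def)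
    qed (simp add: power2_eq_square)
  qed (simp add: power2_eq_square)
qed

definition fill_tables :: com where
  "fill_tables = Assign ''i'' (Var ''n'') ;; WHILE (Less (Num 0) (Var ''i'')) row"

lemma runs_fill_tables:
  assumes "var s ''n'' = int n" "arr s ''C'' = (\<lambda>_ _. 0)" "arr s ''K'' = (\<lambda>_ _. 0)"
    and W: "W = interval_weight (arr s ''f'') (int n) (var s ''first'')"
  shows "runs fill_tables s (200 * (n + 1) ^ 3) (\<lambda>s'. var s' ''n'' = int n \<and>
    filled W (arr s' ''C'') (arr s' ''K'') (int n) 1 (int n + 1))"
    (is "runs fill_tables s _ ?Q")
proof -
  define I where "I s' \<longleftrightarrow> arr s' ''f'' = arr s ''f'' \<and> keeps [''n'', ''first''] s s' \<and>
    var s' ''i'' \<in> {0..int n} \<and>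
    filled W (arr s' ''C'') (arr s' ''K'') (int n) (var s' ''i'' + 1) (int n + 1)" for s'
  show ?thesis
    unfolding fill_tables_def
  proof (rule runs_Seq[where Q = I and t = 2 and u = "200 * (n + 1) ^ 3 - 2"])
    \<comment> \<open>With \<open>i = n\<close> no entry counts as finished yet, so the zero arrays
      satisfy the invariant.\<close>
    show "runs (Assign ''i'' (Var ''n'')) s 2 I"
      using assms
      by (intro runs_loop_free) (auto simp: I_def filled_def zero_below_diagonal_def)
    fix s1 assume s1: "I s1"
    show "runs (WHILE (Less (Num 0) (Var ''i'')) row) s1 (200 * (n + 1) ^ 3 - 2) ?Q"
    proof (rule runs_While[where I = I and V = "\<lambda>s'. nat (var s' ''i'')" and m = n
          and t = "100 * (n + 1) ^ 2"])
      fix s' assume s': "I s'" and b: "bval (Less (Num 0) (Var ''i'')) s'"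
      have W': "W = interval_weight (arr s' ''f'') (int n) (var s' ''first'')"
        using s' W by (simp add: I_def)
      show "runs row s' (100 * (n + 1) ^ 2) (\<lambda>s''. I s'' \<and> nat (var s'' ''i'') < nat (var s' ''i''))"
        by (rule runs_mono[OF runs_row[OF _ _ _ W']])
          (use s' b assms(1) in \<open>auto simp: I_def\<close>)
    next
      fix s' assume s': "I s'" "\<not> bval (Less (Num 0) (Var ''i'')) s'"
      then have "var s' ''i'' = 0" by (simp add: I_def)
      then show "?Q s'"
        using s' assms(1) by (simp add: I_def)
    qed (use s1 in \<open>auto simp: I_def power2_eq_square power3_eq_cube algebra_simps\<close>)
  qed (simp add: power3_eq_cube)
qed

lemma optimal_tables_filled:
  assumes "filled w C K N 1 (N + 1)"
  shows "optimal_tables w C K N"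
proof
  fix i j assume "1 \<le> i" "i \<le> j" "j \<le> N"
  then show "optimal_entry w C K i j"
    using assms by (cases "i = 1") (simp_all add: filled_def)
qed (use assms in \<open>simp_all add: filled_def\<close>)

section \<open>Reading the tree off the table of roots\<close>

definition descend_step :: com where
  "descend_step = IF (Less (Var ''k'') (Get ''K'' (Var ''i'') (Var ''j'')))
     (Assign ''j'' (Minus (Get ''K'' (Var ''i'') (Var ''j'')) (Num 1)))
     (Assign ''i'' (Plus (Get ''K'' (Var ''i'') (Var ''j'')) (Num 1)))"

definition descend_loop :: com where
  "descend_loop = WHILE (Neg (Eq (Get ''K'' (Var ''i'') (Var ''j'')) (Var ''k''))) descend_step"

text \<open>The interval always contains \<open>k\<close>, and every step shortens it; once it is a
  single key, its root must be \<open>k\<close>. The guard excludes the stationary case of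
  \<open>descend\<close>, so \<open>descend_step\<close> makes only one comparison.\<close>

lemma runs_descend_loop:
  assumes "var s ''k'' \<in> {1..int n}" "var s ''i'' = 1" "var s ''j'' = int n"
    and K: "\<And>i j. 1 \<le> i \<Longrightarrow> i \<le> j \<Longrightarrow> j \<le> int n \<Longrightarrow> arr s ''K'' i j \<in> {i..j}"
  shows "runs descend_loop s (40 * n + 20) (\<lambda>s'. arr s' = arr s \<and> keeps [''n'', ''k''] s s' \<and>
    (var s' ''i'', var s' ''j'') \<in> search_path (arr s ''K'') (int n) (var s ''k'') \<and>
    arr s ''K'' (var s' ''i'') (var s' ''j'') = var s ''k'')"
    (is "runs _ _ _ ?Q")
proof -
  define k where "k = var s ''k''"
  define K where "K = arr s ''K''"
  define I where "I s' \<longleftrightarrow> arr s' = arr s \<and> keeps [''n'', ''k''] s s' \<and>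
    (var s' ''i'', var s' ''j'') \<in> search_path K (int n) k \<and>
    1 \<le> var s' ''i'' \<and> var s' ''i'' \<le> k \<and> k \<le> var s' ''j'' \<and> var s' ''j'' \<le> int n" for s' :: store
  show ?thesis
    unfolding descend_loop_def
  proof (rule runs_While[where I = I and V = "\<lambda>s'. nat (var s' ''j'' - var s' ''i'')" and m = n and t = 12])
    show "I s"
      using assms(1-3) search_path_start[of "int n" K k] by (simp add: I_def k_def)
  next
    fix s' assume s': "I s'" "bval (Neg (Eq (Get ''K'' (Var ''i'') (Var ''j'')) (Var ''k''))) s'"
    define i j where "i = var s' ''i''" and "j = var s' ''j''"
    have path: "(i, j) \<in> search_path K (int n) k" and neq: "K i j \<noteq> k"
      and k: "1 \<le> i" "i \<le> k" "k \<le> j" "j \<le> int n"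
      and arr: "arr s' = arr s" "var s' ''n'' = var s ''n''" "var s' ''k'' = k"
      using s' by (auto simp: I_def i_def j_def k_def K_def)
    have Kij: "i \<le> K i j" "K i j \<le> j"
      using k assms(4)[of i j] by (auto simp: K_def)
    show "runs descend_step s' 12
        (\<lambda>s''. I s'' \<and> nat (var s'' ''j'' - var s'' ''i'') < nat (var s' ''j'' - var s' ''i''))"
    proof (cases "k < K i j")
      case True
      then have "(i, K i j - 1) \<in> search_path K (int n) k"
        using search_path_descend[OF path] by (simp add: descend_def)
      then show ?thesis
        unfolding descend_step_def using True arr k Kij
        by (intro runs_loop_free) (auto simp: I_def K_def k_def simp flip: i_def j_def)
    next
      case False
      then have "(K i j + 1, j) \<in> search_path K (int n) k"
        using search_path_descend[OF path] neq by (simp add: descend_def)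
      then show ?thesis
        unfolding descend_step_def using False neq arr k Kij
        by (intro runs_loop_free) (auto simp: I_def K_def k_def simp flip: i_def j_def)
    qed
  next
    fix s' assume "I s'" "\<not> bval (Neg (Eq (Get ''K'' (Var ''i'') (Var ''j'')) (Var ''k''))) s'"
    then show "?Q s'" by (auto simp: I_def K_def k_def)
  qed (use assms(1-3) in auto)
qed

text \<open>The search for \<open>k\<close> ends at the interval of the subtree rooted at
  \<open>k\<close>, so the children are the roots of the two parts beside \<open>k\<close>. An empty
  part is read below the diagonal and yields the null pointer.\<close>

definition link_nodes :: com where
  "link_nodes = Assign ''k'' (Num 1) ;; WHILE (Le (Var ''k'') (Var ''n''))
     ((Assign ''i'' (Num 1) ;; Assign ''j'' (Var ''n'')) ;; descend_loop ;;
      (Put ''left'' (Var ''k'') (Num 0) (Get ''K'' (Var ''i'') (Minus (Var ''k'') (Num 1))) ;;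
       Put ''right'' (Var ''k'') (Num 0) (Get ''K'' (Plus (Var ''k'') (Num 1)) (Var ''j'')) ;;
       Incr ''k''))"

lemma runs_link_nodes:
  assumes n: "var s ''n'' = int n"
    and K: "\<And>i j. 1 \<le> i \<Longrightarrow> i \<le> j \<Longrightarrow> j \<le> int n \<Longrightarrow> arr s ''K'' i j \<in> {i..j}"
  shows "runs link_nodes s (200 * (n + 1) ^ 2) (\<lambda>s'. arr s' ''K'' = arr s ''K'' \<and>
    var s' ''n'' = int n \<and>
    (\<forall>k\<in>{1..int n}. linked (arr s ''K'') (int n) s' k))"
    (is "runs _ _ _ ?Q")
proof -
  define K where "K = arr s ''K''"
  define I where "I s' \<longleftrightarrow> arr s' ''K'' = K \<and> var s' ''n'' = int n \<and> var s' ''k'' \<in> {1..int n + 1} \<and>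
    (\<forall>k\<in>{1..<var s' ''k''}. linked K (int n) s' k)" for s' :: store
  show ?thesis
    unfolding link_nodes_def
  proof (rule runs_Seq[where Q = I and t = 2 and u = "200 * (n + 1) ^ 2 - 2"])
    show "runs (Assign ''k'' (Num 1)) s 2 I"
      using n by (intro runs_loop_free) (auto simp: I_def K_def)
    fix s1 assume s1: "I s1"
    show "runs (WHILE (Le (Var ''k'') (Var ''n''))
     ((Assign ''i'' (Num 1) ;; Assign ''j'' (Var ''n'')) ;; descend_loop ;;
      (Put ''left'' (Var ''k'') (Num 0) (Get ''K'' (Var ''i'') (Minus (Var ''k'') (Num 1))) ;;
       Put ''right'' (Var ''k'') (Num 0) (Get ''K'' (Plus (Var ''k'') (Num 1)) (Var ''j'')) ;;
       Incr ''k''))) s1 (200 * (n + 1) ^ 2 - 2) ?Q"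
    proof (rule runs_While[where I = I and V = "\<lambda>s'. nat (int n + 1 - var s' ''k'')" and m = n
          and t = "40 * n + 60"])
      fix s2 assume s2: "I s2" "bval (Le (Var ''k'') (Var ''n'')) s2"
      define k where "k = var s2 ''k''"
      have k: "1 \<le> k" "k \<le> int n"
        using s2 by (auto simp: I_def k_def)
      define Q1 where "Q1 s' \<longleftrightarrow> arr s' = arr s2 \<and> keeps [''n'', ''k''] s2 s' \<and> var s' ''i'' = 1 \<and>
        var s' ''j'' = int n" for s' :: store
      define Q2 where "Q2 s' \<longleftrightarrow> arr s' = arr s2 \<and> keeps [''n'', ''k''] s2 s' \<and>
        (var s' ''i'', var s' ''j'') \<in> search_path K (int n) k \<and> K (var s' ''i'') (var s' ''j'') = k" for s' :: store
      show "runs ((Assign ''i'' (Num 1) ;; Assign ''j'' (Var ''n'')) ;; descend_loop ;;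
        (Put ''left'' (Var ''k'') (Num 0) (Get ''K'' (Var ''i'') (Minus (Var ''k'') (Num 1))) ;;
         Put ''right'' (Var ''k'') (Num 0) (Get ''K'' (Plus (Var ''k'') (Num 1)) (Var ''j'')) ;;
         Incr ''k'')) s2 (40 * n + 60)
        (\<lambda>s'. I s' \<and> nat (int n + 1 - var s' ''k'') < nat (int n + 1 - var s2 ''k''))"
      proof (rule runs_Seq[where Q = Q1 and t = 4 and u = "40 * n + 56"])
        show "runs (Assign ''i'' (Num 1) ;; Assign ''j'' (Var ''n'')) s2 4 Q1"
          using s2 by (intro runs_loop_free) (auto simp: Q1_def I_def)
        fix s3 assume s3: "Q1 s3"
        show "runs (descend_loop ;;
          (Put ''left'' (Var ''k'') (Num 0) (Get ''K'' (Var ''i'') (Minus (Var ''k'') (Num 1))) ;;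
           Put ''right'' (Var ''k'') (Num 0) (Get ''K'' (Plus (Var ''k'') (Num 1)) (Var ''j'')) ;;
           Incr ''k'')) s3 (40 * n + 56)
          (\<lambda>s'. I s' \<and> nat (int n + 1 - var s' ''k'') < nat (int n + 1 - var s2 ''k''))"
        proof (rule runs_Seq[where Q = Q2 and t = "40 * n + 20" and u = 36])
          have s3': "arr s3 ''K'' = K" "var s3 ''k'' = k" "arr s3 = arr s2" "keeps [''n'', ''k''] s2 s3"
            "var s3 ''i'' = 1" "var s3 ''j'' = int n"
            using s2 s3 by (auto simp: Q1_def I_def k_def)
          show "runs descend_loop s3 (40 * n + 20) Q2"
          proof (rule runs_mono[OF runs_descend_loop[of s3 n]])
            show "arr s3 ''K'' i j \<in> {i..j}" if "1 \<le> i" "i \<le> j" "j \<le> int n" for i j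
              using K[OF that] s3'(1) by (simp add: K_def)
          qed (use s3' k in \<open>auto simp: Q2_def\<close>)
          fix s4 assume s4: "Q2 s4"
          define c where "c = Put ''left'' (Var ''k'') (Num 0) (Get ''K'' (Var ''i'') (Minus (Var ''k'') (Num 1))) ;;
           Put ''right'' (Var ''k'') (Num 0) (Get ''K'' (Plus (Var ''k'') (Num 1)) (Var ''j'')) ;;
           Incr ''k''"
          have Ks4: "arr s4 ''K'' = K" "var s4 ''k'' = k" "var s4 ''n'' = int n"
            using s2 s4 by (auto simp: Q2_def I_def k_def)
          have new: "arr (result c s4) ''left'' k 0 = K (var s4 ''i'') (k - 1)"
            "arr (result c s4) ''right'' k 0 = K (k + 1) (var s4 ''j'')"
            "var (result c s4) ''k'' = k + 1" "var (result c s4) ''n'' = int n"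
            "arr (result c s4) ''K'' = K"
            using Ks4 by (auto simp: c_def put_def)
          \<comment> \<open>Only the pointers of \<open>k\<close> are written, so the links of
            smaller keys survive.\<close>
          have old: "arr (result c s4) ''left'' x 0 = arr s2 ''left'' x 0"
            "arr (result c s4) ''right'' x 0 = arr s2 ''right'' x 0" if "x \<noteq> k" for x
            using that s4 Ks4 by (auto simp: c_def put_def Q2_def)
          have "linked K (int n) (result c s4) k"
            unfolding linked_def
          proof (intro allI impI)
            fix i j assume "(i, j) \<in> search_path K (int n) k \<and> K i j = k"
            then have "i = var s4 ''i'' \<and> j = var s4 ''j''"
              using s4 by (intro search_path_end_unique[where K = K and N = "int n" and k = k]) (auto simp: Q2_def)
            then show "arr (result c s4) ''left'' k 0 = K i (k - 1) \<and>
                arr (result c s4) ''right'' k 0 = K (k + 1) j"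
              using new by simp
          qed
          moreover have "linked K (int n) (result c s4) x" if "x \<in> {1..<k}" for x
          proof -
            have "linked K (int n) s2 x" "x \<noteq> k"
              using s2 that by (auto simp: I_def k_def)
            then show ?thesis using old[of x] by (simp add: linked_def)
          qed
          ultimately have "linked K (int n) (result c s4) x" if "x \<in> {1..<k + 1}" for x
            using that by (cases "x = k") auto
          then have "I (result c s4)"
            using new k by (simp add: I_def)
          then show "runs c s4 36 (\<lambda>s'. I s' \<and> nat (int n + 1 - var s' ''k'') < nat (int n + 1 - var s2 ''k''))"
            using new(3) k by (intro runs_loop_free) (auto simp: c_def k_def)
        qed simp
      qed simp
    next
      fix s' assume s': "I s'" "\<not> bval (Le (Var ''k'') (Var ''n'')) s'"
      then have "var s' ''k'' = int n + 1" by (auto simp: I_def)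
      with s' show "?Q s'" by (simp add: I_def K_def)
    qed (use s1 in \<open>auto simp: I_def power2_eq_square algebra_simps\<close>)
  qed (simp add: power2_eq_square)
qed

section \<open>Correctness and running time of the whole program\<close>

definition optimal_bst_program :: com where
  "optimal_bst_program = find_first ;; fill_tables ;; link_nodes ;;
     Assign ''root'' (Get ''K'' (Num 1) (Var ''n''))"

text \<open>This joins the two sides: the cost of a tree speaks of the sequence, the tables only of
  the frequencies and the first key.\<close>

lemma seq_weight_eq_interval_weight:
  assumes "X \<noteq> []" "set X \<subseteq> {1..n}" "int ` S = {i..j}"
    and F: "\<And>a b. a \<in> {1..int n} \<Longrightarrow> b \<in> {1..int n} \<Longrightarrow> F a b = int_freq X a b"
  shows "seq_weight X S = interval_weight F (int n) (int (hd X)) i j"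
proof -
  have mem: "x \<in> S \<longleftrightarrow> int x \<in> {i..j}" for x
    using assms(3) by (metis image_iff of_nat_eq_iff)
  have "(\<Sum>a = 1..<length X. of_bool ((X ! (a - 1) \<in> S) \<noteq> (X ! a \<in> S))) =
      crossings (int_freq X) (int n) {i..j}"
    unfolding crossings_def mem by (rule sum_transitions[OF assms(2)])
  also have "\<dots> = crossings F (int n) {i..j}"
    unfolding crossings_def by (intro sum.cong refl) (simp add: F)
  finally show ?thesis
    unfolding seq_weight_def interval_weight_def mem by simp
qed

lemma runs_optimal_bst_program:
  assumes "n \<ge> 1" "X \<noteq> []" "set X \<subseteq> {1..n}" "hd X = last X \<longrightarrow> h = hd X"
  shows "runs optimal_bst_program (input_store n (freq X) h) (500 * (n + 1) ^ 3)
    (\<lambda>s. \<exists>T. outputs_tree s T \<and> optimal_bst n X T)"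
    (is "runs _ ?s _ ?Q")
proof -
  define F where "F = arr ?s ''f''"
  define W where "W = interval_weight F (int n) (int (hd X))"
  have F: "F a b = int_freq X a b" if "a \<in> {1..int n}" "b \<in> {1..int n}" for a b
    using that by (simp add: F_def input_store_def int_freq_def)
  have hd: "hd X \<in> {1..n}"
    using assms(2,3) hd_in_set by blast
  define Q1 where "Q1 s \<longleftrightarrow> arr s = arr ?s \<and> var s ''n'' = int n \<and> var s ''first'' = int (hd X)" for s :: store
  define Q2 where "Q2 s \<longleftrightarrow> var s ''n'' = int n \<and>
    filled W (arr s ''C'') (arr s ''K'') (int n) 1 (int n + 1)" for s :: store
  \<comment> \<open>Lets the cubic budget absorb the quadratic phases, which are finding the first
    key and linking the nodes.\<close>
  have pow: "(n + 1) ^ 2 \<le> (n + 1) ^ 3"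
    by (rule power_increasing) auto
  show ?thesis
    unfolding optimal_bst_program_def
  proof (rule runs_Seq[where Q = Q1 and t = "60 * (n + 1) ^ 2" and u = "440 * (n + 1) ^ 3"])
    show "runs find_first ?s (60 * (n + 1) ^ 2) Q1"
    proof (rule runs_mono[OF runs_find_first[where n = n and x = "int (hd X)" and y = "int (last X)"]])
      fix a assume a: "a \<in> {1..int n}"
      have "(\<Sum>b = 1..int n. F a b - F b a) = (\<Sum>b = 1..int n. int_freq X a b - int_freq X b a)"
        using a by (intro sum.cong refl) (simp add: F)
      then show "(\<Sum>b = 1..int n. arr ?s ''f'' a b - arr ?s ''f'' b a) =
          of_bool (int (hd X) = a) - of_bool (int (last X) = a)"
        using departures_minus_arrivals[OF assms(2,3) a] by (simp add: F_def)
    qed (use assms hd in \<open>auto simp: Q1_def input_store_def\<close>)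
    fix s1 assume s1: "Q1 s1"
    show "runs (fill_tables ;; link_nodes ;; Assign ''root'' (Get ''K'' (Num 1) (Var ''n''))) s1
      (440 * (n + 1) ^ 3) ?Q"
    proof (rule runs_Seq[where Q = Q2 and t = "200 * (n + 1) ^ 3" and u = "240 * (n + 1) ^ 3"])
      show "runs fill_tables s1 (200 * (n + 1) ^ 3) Q2"
        by (rule runs_mono[OF runs_fill_tables[where n = n and W = W]])
          (use s1 in \<open>auto simp: Q1_def Q2_def W_def F_def input_store_def\<close>)
      fix s2 assume s2: "Q2 s2"
      define C K where "C = arr s2 ''C''" and "K = arr s2 ''K''"
      interpret optimal_tables W C K "int n"
        using s2 by (intro optimal_tables_filled) (simp add: Q2_def C_def K_def)
      have K: "K i j \<in> {i..j}" if "1 \<le> i" "i \<le> j" "j \<le> int n" for i j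
        using entry[OF that] by (simp add: optimal_entry_def)
      define Q3 where "Q3 s' \<longleftrightarrow> arr s' ''K'' = K \<and> var s' ''n'' = int n \<and>
        (\<forall>k\<in>{1..int n}. linked K (int n) s' k)" for s' :: store
      show "runs (link_nodes ;; Assign ''root'' (Get ''K'' (Num 1) (Var ''n''))) s2
        (240 * (n + 1) ^ 3) ?Q"
      proof (rule runs_Seq[where Q = Q3 and t = "200 * (n + 1) ^ 2" and u = 4])
        show "runs link_nodes s2 (200 * (n + 1) ^ 2) Q3"
          by (rule runs_mono[OF runs_link_nodes[where n = n]])
            (use s2 K in \<open>simp_all add: Q2_def Q3_def K_def\<close>)
        fix s3 assume s3: "Q3 s3"
        \<comment> \<open>The final store, named in advance: assigning \<open>root\<close> leaves
          all arrays unchanged, so the links of \<open>s3\<close> carry over to it.\<close>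
        define s4 where "s4 = s3\<lparr>var := (var s3)(''root'' := K 1 (int n))\<rparr>"
        have weight: "seq_weight X S = W i j" if "int ` S = {i..j}" for S i j
          unfolding W_def by (rule seq_weight_eq_interval_weight[OF assms(2,3) that F])
        have "linked K (int n) s4 k" if "k \<in> {1..int n}" for k
          using s3 that by (simp add: s4_def Q3_def linked_def)
        then obtain T where T: "bst T" "int ` set_tree T = {1..int n}"
          "node_sum (seq_weight X) T = C 1 (int n)" "tree_at s4 (K 1 (int n)) T"
          using optimal_tree_exists[of 1 "int n" "seq_weight X" s4] weight search_path_start by auto
        \<comment> \<open>Injectivity of \<open>int\<close> translates the integer intervals of the
          tables into the key set demanded by \<open>bst_on\<close>.\<close>
        have "int ` A = {1..int n} \<longleftrightarrow> A = {1..n}" for A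
        proof -
          have "{1..int n} = int ` {1..n}"
            by (simp add: image_int_atLeastAtMost)
          then show ?thesis by (simp add: inj_image_eq_iff)
        qed
        note keys = this
        have "optimal_bst n X T"
          unfolding optimal_bst_def
        proof (intro conjI allI impI)
          show "bst_on n T" using T(1,2) keys by (simp add: bst_on_def)
          fix T' assume T': "bst_on n T'"
          have "lazy_finger_cost T X = C 1 (int n) - 1"
            using T assms(2,3) keys lazy_finger_cost_eq_node_sum[of T X] by simp
          moreover have "C 1 (int n) \<le> node_sum (seq_weight X) T'"
            using T' keys weight by (intro cost_lower_bound) (auto simp: bst_on_def)
          moreover have "lazy_finger_cost T' X = node_sum (seq_weight X) T' - 1"
            using T' assms(2,3) by (intro lazy_finger_cost_eq_node_sum) (auto simp: bst_on_def)
          ultimately show "lazy_finger_cost T X \<le> lazy_finger_cost T' X" by simp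
        qed
        moreover have "outputs_tree s4 T"
          using T(4) by (simp add: outputs_tree_def s4_def)
        moreover have "result (Assign ''root'' (Get ''K'' (Num 1) (Var ''n''))) s3 = s4"
          using s3 by (simp add: s4_def Q3_def)
        ultimately show "runs (Assign ''root'' (Get ''K'' (Num 1) (Var ''n''))) s3 4 ?Q"
          by (intro runs_loop_free) auto
      qed (use pow in \<open>simp add: power3_eq_cube\<close>)
    qed simp
  qed (use pow in simp)
qed

theorem theorem4:
  shows "\<exists>(P :: com) (t :: nat \<Rightarrow> nat).
    (\<lambda>n. real (t n)) \<in> O(\<lambda>n. real n ^ 3) \<and>
    (\<forall>(n :: nat) (X :: nat list) (h :: nat).
       n \<ge> 1 \<and> X \<noteq> [] \<and> set X \<subseteq> {1..n} \<and> (hd X = last X \<longrightarrow> h = hd X) \<longrightarrow>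
       (\<exists>k s T. exec P (input_store n (freq X) h) k s \<and> k \<le> t n \<and>
                outputs_tree s T \<and> optimal_bst n X T))"
proof (rule exI[of _ optimal_bst_program], rule exI[of _ "\<lambda>n. 500 * (n + 1) ^ 3"],
    intro conjI allI impI)
  \<comment> \<open>For \<open>n \<ge> 1\<close> one has \<open>n + 1 \<le> 2 * n\<close>, and 4000
    is 500 times the cube of 2.\<close>
  have "real (500 * (n + 1) ^ 3) \<le> 4000 * real n ^ 3" if "n \<ge> 1" for n
  proof -
    have "(n + 1) ^ 3 \<le> (2 * n) ^ 3"
      using that by (intro power_mono) auto
    then have "500 * (n + 1) ^ 3 \<le> 4000 * n ^ 3"
      by (simp add: power_mult_distrib)
    then have "real (500 * (n + 1) ^ 3) \<le> real (4000 * n ^ 3)"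
      by (rule of_nat_mono)
    then show ?thesis by simp
  qed
  then show "(\<lambda>n. real (500 * (n + 1) ^ 3)) \<in> O(\<lambda>n. real n ^ 3)"
    by (intro bigoI[of _ 4000] eventually_at_top_linorderI[of 1]) auto
next
  fix n h :: nat and X :: "nat list"
  assume "n \<ge> 1 \<and> X \<noteq> [] \<and> set X \<subseteq> {1..n} \<and> (hd X = last X \<longrightarrow> h = hd X)"
  then show "\<exists>k s T. exec optimal_bst_program (input_store n (freq X) h) k s \<and>
      k \<le> 500 * (n + 1) ^ 3 \<and> outputs_tree s T \<and> optimal_bst n X T"
    using runs_optimal_bst_program[of n X h] unfolding runs_def by blast
qed

end
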